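(* Fix $T>0$, $\varepsilon>0$ and let $V_1=\mathcal N_p$ with $p=1$ or $p=2$. Suppose $\rho_0\in\mathcal P_2(\mathbb R^d)$ satisfies $\mathcal H^\varepsilon[\rho_0]<+\infty$. Then there exists a weak measure solution $\rho^\varepsilon$ on $[0,T]$ of $$\partial_t\rho=\nabla\cdot\big(\rho\,\nabla V_\varepsilon*\log(V_\varepsilon*\rho)\big)$$ such that $\rho^\varepsilon(0)=\rho_0$.
   Context: $\mathcal P_2(\mathbb R^d)$ is the set of Borel probability measures on $\mathbb R^d$ with finite second moment, equipped with the 2-Wasserstein distance $d_W$. $\langle x\rangle:=\sqrt{1+|x|^2}$. For $p=1,2$, $\mathcal N_p(x):=Z^{-1}\exp(-\langle x\rangle^p)$ with $Z$ the normalising constant so that $\int\mathcal N_p\,dx=1$. For $\varepsilon>0$, $V_\varepsilon(x):=\varepsilon^{-d}V_1(x/\varepsilon)$. For $\rho\in\mathcal P_2(\mathbb R^d)$, $\mathcal H^\varepsilon[\rho]:=\int_{\mathbb R^d}(V_\varepsilon*\rho)\log(V_\varepsilon*\rho)\,dx$. Weak measure solution: an absolutely continuous curve $\rho:[0,T]\to(\mathcal P_2(\mathbb R^d),d_W)$ such that for every $\varphi\in C^1_c(\mathbb R^d)$ and every $t\in[0,T]$, $$\int\varphi\,d\rho_t-\int\varphi\,d\rho_0=-\int_0^t\int_{\mathbb R^d}\nabla\varphi(x)\cdot\nabla V_\varepsilon*[\log(V_\varepsilon*\rho_s)](x)\,d\rho_s(x)\,ds .$$ *)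

theory Defs
  imports "HOL-Probability.Probability"
begin

section \<open>Probability measures with finite second moment\<close>

definition P2 :: "'a::euclidean_space measure set" where
  "P2 = {\<mu>. prob_space \<mu> \<and> sets \<mu> = sets borel \<and> (\<integral>\<^sup>+x. ennreal ((norm x)\<^sup>2) \<partial>\<mu>) < \<infinity>}"

definition couplings :: "'a::euclidean_space measure \<Rightarrow> 'a measure \<Rightarrow> ('a \<times> 'a) measure set" where
  "couplings \<mu> \<nu> = {\<gamma>. prob_space \<gamma> \<and> sets \<gamma> = sets (borel \<Otimes>\<^sub>M borel) \<and>
     distr \<gamma> borel fst = \<mu> \<and> distr \<gamma> borel snd = \<nu>}"

text \<open>The 2-Wasserstein distance. The infimum is finite for arguments in \<^const>\<open>P2\<close>, so that
  \<^const>\<open>enn2real\<close> loses nothing there.\<close>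

definition wasserstein2 :: "'a::euclidean_space measure \<Rightarrow> 'a measure \<Rightarrow> real" where
  "wasserstein2 \<mu> \<nu> =
     sqrt (enn2real (INF \<gamma>\<in>couplings \<mu> \<nu>. \<integral>\<^sup>+z. ennreal ((dist (fst z) (snd z))\<^sup>2) \<partial>\<gamma>))"

text \<open>Absolutely continuous curves \<open>[0,T] \<rightarrow> (X,d)\<close> in the sense of Ambrosio, Gigli and Savare:
  \<open>d (u s) (u t)\<close> is controlled by the integral over \<open>[s,t]\<close> of a fixed \<open>m\<close> in \<open>L\<^sup>1(0,T)\<close>.\<close>

definition abs_cont_curve ::
  "'x set \<Rightarrow> ('x \<Rightarrow> 'x \<Rightarrow> real) \<Rightarrow> real \<Rightarrow> (real \<Rightarrow> 'x) \<Rightarrow> bool" where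
  "abs_cont_curve X d T u \<longleftrightarrow> (\<forall>t\<in>{0..T}. u t \<in> X) \<and>
     (\<exists>m::real \<Rightarrow> real. set_integrable lborel {0..T} m \<and>
        (\<forall>s t. 0 \<le> s \<and> s \<le> t \<and> t \<le> T \<longrightarrow> d (u s) (u t) \<le> (LINT r:{s..t}|lborel. m r)))"

section \<open>Mollifiers, convolutions and the regularised entropy\<close>

definition jap :: "'a::euclidean_space \<Rightarrow> real" where
  "jap x = sqrt (1 + (norm x)\<^sup>2)"

definition kernelN :: "nat \<Rightarrow> 'a::euclidean_space \<Rightarrow> real" where
  "kernelN p x = exp (- (jap x ^ p)) / (LINT y|(lborel :: 'a measure). exp (- (jap y ^ p)))"

definition rescale :: "('a::euclidean_space \<Rightarrow> real) \<Rightarrow> real \<Rightarrow> 'a \<Rightarrow> real" where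
  "rescale V \<epsilon> x = V (x /\<^sub>R \<epsilon>) / \<epsilon> ^ DIM('a)"

definition conv_measure :: "('a::euclidean_space \<Rightarrow> real) \<Rightarrow> 'a measure \<Rightarrow> 'a \<Rightarrow> real" where
  "conv_measure V \<rho> x = (LINT y|\<rho>. V (x - y))"

definition conv_vec :: "('a::euclidean_space \<Rightarrow> 'a) \<Rightarrow> ('a \<Rightarrow> real) \<Rightarrow> 'a \<Rightarrow> 'a" where
  "conv_vec K f x = (LINT y|lborel. f y *\<^sub>R K (x - y))"

text \<open>The integral of \<open>(V * \<rho>) log (V * \<rho>)\<close> as positive part minus negative part, so that the value
  \<open>\<infinity>\<close> is possible. In \<^typ>\<open>ereal\<close> the convention is \<open>\<infinity> - \<infinity> = \<infinity>\<close>, hence a value below \<open>\<infinity>\<close> forces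
  the positive part to be integrable.\<close>

definition reg_entropy :: "('a::euclidean_space \<Rightarrow> real) \<Rightarrow> 'a measure \<Rightarrow> ereal" where
  "reg_entropy V \<rho> =
     enn2ereal (\<integral>\<^sup>+x. ennreal (conv_measure V \<rho> x * ln (conv_measure V \<rho> x)) \<partial>lborel)
   - enn2ereal (\<integral>\<^sup>+x. ennreal (- (conv_measure V \<rho> x * ln (conv_measure V \<rho> x))) \<partial>lborel)"

section \<open>Weak measure solutions\<close>

definition gradient :: "('a::euclidean_space \<Rightarrow> real) \<Rightarrow> 'a \<Rightarrow> 'a" where
  "gradient f x = (THE g. GDERIV f x :> g)"

lemma gradient_eqI: "GDERIV f x :> g \<Longrightarrow> gradient f x = g"
  unfolding gradient_def
proof (rule the_equality)
  fix h assume g: "GDERIV f x :> g" and h: "GDERIV f x :> h"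
  then have "(\<lambda>v. v \<bullet> g) = (\<lambda>v. v \<bullet> h)"
    unfolding gderiv_def by (rule has_derivative_unique)
  then have "(h - g) \<bullet> g = (h - g) \<bullet> h"
    by (rule fun_cong)
  then have "(h - g) \<bullet> (h - g) = 0"
    by (simp only: inner_diff_right diff_self)
  then show "h = g" by simp
qed

definition C1_compact_support :: "('a::euclidean_space \<Rightarrow> real) \<Rightarrow> bool" where
  "C1_compact_support \<phi> \<longleftrightarrow> (\<forall>x. \<phi> differentiable (at x)) \<and>
     continuous_on UNIV (gradient \<phi>) \<and> compact (closure {x. \<phi> x \<noteq> 0})"

text \<open>Weak measure solutions on \<open>[0,T]\<close> of
  \<open>\<partial>\<^sub>t \<rho> = div (\<rho> (\<nabla>V * log (V * \<rho>)))\<close>. For the mollifiers above, all integrals exist along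
  an absolutely continuous curve in \<^const>\<open>P2\<close>: the logarithm grows at most polynomially, \<open>\<nabla>V\<close>
  decays exponentially, and the integrand of the time integral is continuous.\<close>

definition weak_measure_solution ::
  "('a::euclidean_space \<Rightarrow> real) \<Rightarrow> real \<Rightarrow> (real \<Rightarrow> 'a measure) \<Rightarrow> bool" where
  "weak_measure_solution V T \<rho> \<longleftrightarrow> abs_cont_curve P2 wasserstein2 T \<rho> \<and>
     (\<forall>\<phi>. C1_compact_support \<phi> \<longrightarrow> (\<forall>t\<in>{0..T}.
        (LINT x|\<rho> t. \<phi> x) - (LINT x|\<rho> 0. \<phi> x) =
        - (LINT s:{0..t}|lborel. LINT x|\<rho> s.
             gradient \<phi> x \<bullet> conv_vec (gradient V) (\<lambda>y. ln (conv_measure V (\<rho> s) y)) x)))"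

end

(* The equation is solved in Lagrangian form: rho_t is the image of rho_0 under maps X_t with
   X_0 = id and d/dt X_t(x) = v[X_t](X_t(x)), where v[X] = - grad V * ln (V * (X # rho_0)).
   Since V is radially decreasing and ln V has a derivative of at most linear growth,
   ln (V * rho) has one too, and as grad V is odd, v[X](z) is bounded linearly in |z| and the first
   moment of X # rho_0, and is locally Lipschitz in z.
   The explicit Euler scheme for X is therefore locally equicontinuous with linear growth; along a
   subsequence it converges pointwise, and dominated convergence against rho_0 passes to the limit
   in v.  Integrating phi(X_t(x)) along the flow yields the weak formulation. *)
theory Submission
  imports Defs "HOL-Complex_Analysis.Great_Picard"
begin

section \<open>Preliminaries\<close>

text \<open>For \<open>p = 2\<close> the function ln (V * rho) may grow quadratically, and a
  velocity of quadratic growth could blow up in finite time; linear growth is what keeps the flow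
  alive on all of [0,T]. One power is saved because grad V has mean zero, so that only increments of
  the logarithm count. Estimating such an increment naturally produces the mean distance to the
  particles under a tilted measure; monotonicity of V replaces it by the ordinary mean. Hence only
  the first moment enters, and |X(x)| together with that moment obeys a closed linear recursion
  along the scheme. The dependence of v on X is controlled only qualitatively: comparing logarithms
  means dividing by a density that decays at infinity, so what is proved is continuity under
  pointwise convergence, not a Lipschitz bound in X. This is why compactness replaces a contraction
  argument. The local Lipschitz bound in z serves for equicontinuity in the starting point.\<close>

lemma norm_diff_le_one_plus:
  fixes z u :: "'a::real_normed_vector"
  shows "1 + norm (z - u) \<le> (1 + norm z) * (1 + norm u)"
proof -
  have "1 + norm (z - u) \<le> 1 + norm z + norm u + norm z * norm u"
    using norm_triangle_ineq4[of z u] by (simp add: add_increasing2)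
  then show ?thesis by (simp add: algebra_simps)
qed

lemma integral_reflect_lborel:
  fixes f :: "'a::euclidean_space \<Rightarrow> 'b::{banach, second_countable_topology}" and z :: 'a
  assumes [measurable]: "f \<in> borel_measurable borel"
  shows "(LINT y|lborel. f (z - y)) = (LINT y|lborel. f y)"
proof -
  have "(lborel :: 'a measure) = distr lborel borel (\<lambda>y. z - y)"
    using lborel_affine[of "-1" z] by (simp add: density_1 one_ennreal_def[symmetric])
  then have "(LINT y|lborel. f y) = (LINT y|distr lborel borel (\<lambda>y. z - y). f y)"
    by simp
  also have "\<dots> = (LINT y|lborel. f (z - y))"
    by (rule integral_distr) auto
  finally show ?thesis ..
qed

text \<open>Discrete Gronwall factor: steps of length \<open>h\<close> within total time
  \<open>T\<close> amplify by an amount that does not depend on \<open>h\<close>.\<close>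

lemma power_one_plus_mult_le_exp:
  fixes a h T :: real
  assumes "0 \<le> a" "0 \<le> h" "real k * h \<le> T"
  shows "(1 + h * a) ^ k \<le> exp (a * T)"
proof -
  have "(1 + h * a) ^ k \<le> exp (h * a) ^ k"
    using assms by (intro power_mono exp_ge_add_one_self) auto
  also have "\<dots> = exp (a * (real k * h))"
    by (simp add: mult.commute mult.left_commute flip: exp_of_nat_mult)
  also have "\<dots> \<le> exp (a * T)"
    using assms by (simp add: mult_left_mono)
  finally show ?thesis .
qed

text \<open>A variant of Arzela-Ascoli for pointwise convergence: a diagonal subsequence converging
  on a countable dense \<open>D\<close> is Cauchy everywhere by three estimates of size
  \<open>e / 3\<close>. Equicontinuity is required only from some index \<open>N\<close> on, because
  the Euler curves jump in time and only the size of the jumps tends to 0.\<close>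

lemma asymptotically_equicontinuous_subsequence:
  fixes f :: "nat \<Rightarrow> 'p::euclidean_space \<Rightarrow> 'b::euclidean_space"
  assumes bdd: "\<And>p. p \<in> S \<Longrightarrow> \<exists>c>0. \<forall>n. norm (f n p) \<le> c"
    and equi: "\<And>p e. p \<in> S \<Longrightarrow> 0 < e \<Longrightarrow>
      \<exists>\<delta>>0. \<exists>N. \<forall>n\<ge>N. \<forall>q\<in>S. dist p q < \<delta> \<longrightarrow> dist (f n p) (f n q) < e"
  obtains \<sigma> :: "nat \<Rightarrow> nat" and g where "strict_mono \<sigma>" "\<And>p. p \<in> S \<Longrightarrow> (\<lambda>n. f (\<sigma> n) p) \<longlonglongrightarrow> g p"
proof -
  obtain D where D: "countable D" "D \<subseteq> S" "S \<subseteq> closure D"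
    using separable[of S] by blast
  obtain c where c: "\<And>p. p \<in> S \<Longrightarrow> 0 < c p \<and> (\<forall>n. norm (f n p) \<le> c p)"
    using bdd by metis
  \<comment> \<open>Dividing by \<open>c p\<close> turns the pointwise bounds into the uniform bound
    1 that \<open>function_convergent_subsequence\<close> expects.\<close>
  obtain \<sigma> :: "nat \<Rightarrow> nat" where \<sigma>: "strict_mono \<sigma>"
    "\<And>p. p \<in> D \<Longrightarrow> \<exists>l. (\<lambda>n. f (\<sigma> n) p /\<^sub>R c p) \<longlonglongrightarrow> l"
  proof (rule function_convergent_subsequence[of D "\<lambda>n p. f n p /\<^sub>R c p" 1])
    show "norm (f n p /\<^sub>R c p) \<le> 1" if "p \<in> D" for n p
      using c[of p] that D by (auto simp: divide_simps)
  qed (use D in auto)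
  have conv_D: "Cauchy (\<lambda>n. f (\<sigma> n) p)" if "p \<in> D" for p
  proof -
    obtain l where "(\<lambda>n. f (\<sigma> n) p /\<^sub>R c p) \<longlonglongrightarrow> l" using \<sigma>(2) \<open>p \<in> D\<close> by blast
    then have "(\<lambda>n. c p *\<^sub>R (f (\<sigma> n) p /\<^sub>R c p)) \<longlonglongrightarrow> c p *\<^sub>R l" by (intro tendsto_intros)
    moreover have "c p \<noteq> 0" using c[of p] \<open>p \<in> D\<close> D by auto
    ultimately show ?thesis by (simp add: LIMSEQ_imp_Cauchy)
  qed
  have "convergent (\<lambda>n. f (\<sigma> n) p)" if "p \<in> S" for p
  proof (rule Cauchy_convergent, rule metric_CauchyI)
    fix e :: real assume "0 < e"
    then obtain \<delta> N where \<delta>: "0 < \<delta>"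
      "\<And>n q. n \<ge> N \<Longrightarrow> q \<in> S \<Longrightarrow> dist p q < \<delta> \<Longrightarrow> dist (f n p) (f n q) < e / 3"
      using equi[OF \<open>p \<in> S\<close>, of "e / 3"] by (metis divide_pos_pos zero_less_numeral)
    obtain q where q: "q \<in> D" "dist q p < \<delta>"
      using D \<open>p \<in> S\<close> \<open>0 < \<delta>\<close> by (meson closure_approachable subsetD)
    obtain M where M: "\<And>m n. m \<ge> M \<Longrightarrow> n \<ge> M \<Longrightarrow> dist (f (\<sigma> m) q) (f (\<sigma> n) q) < e / 3"
      using metric_CauchyD[OF conv_D[OF q(1)], of "e / 3"] \<open>0 < e\<close> by auto
    have "dist (f (\<sigma> m) p) (f (\<sigma> n) p) < e" if "m \<ge> max M N" "n \<ge> max M N" for m n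
    proof -
      have "\<sigma> m \<ge> N" "\<sigma> n \<ge> N"
        using that seq_suble[OF \<sigma>(1)] by (meson le_trans max.boundedE)+
      then have "dist (f (\<sigma> m) p) (f (\<sigma> m) q) < e / 3" "dist (f (\<sigma> n) p) (f (\<sigma> n) q) < e / 3"
        using \<delta>(2)[of "\<sigma> m" q] \<delta>(2)[of "\<sigma> n" q] q D by (auto simp: dist_commute)
      moreover have "dist (f (\<sigma> m) q) (f (\<sigma> n) q) < e / 3" using M that by auto
      ultimately show ?thesis
        using dist_triangle[of "f (\<sigma> m) p" "f (\<sigma> n) p" "f (\<sigma> m) q"]
          dist_triangle[of "f (\<sigma> m) q" "f (\<sigma> n) p" "f (\<sigma> n) q"]
        by (simp add: dist_commute)
    qed
    then show "\<exists>M. \<forall>m\<ge>M. \<forall>n\<ge>M. dist (f (\<sigma> m) p) (f (\<sigma> n) p) < e" by blast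
  qed
  then show ?thesis
    using that[OF \<sigma>(1), of "\<lambda>p. lim (\<lambda>n. f (\<sigma> n) p)"] by (simp add: convergent_LIMSEQ_iff)
qed

lemma gderiv_gradient:
  fixes \<phi> :: "'a::euclidean_space \<Rightarrow> real"
  assumes "\<phi> differentiable (at x)"
  shows "GDERIV \<phi> x :> gradient \<phi> x"
proof -
  obtain D where D: "(\<phi> has_derivative D) (at x)"
    using assms by (auto simp: differentiable_def)
  then have lin: "linear D" by (rule has_derivative_linear)
  \<comment> \<open>The Riesz vector of the functional \<open>D\<close> is its adjoint applied to
    1.\<close>
  have "D v = v \<bullet> adjoint D 1" for v
    using adjoint_works[OF lin, of v 1] by simp
  then have "D = (\<lambda>v. v \<bullet> adjoint D 1)" by auto
  then have "GDERIV \<phi> x :> adjoint D 1"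
    using D by (simp add: gderiv_def)
  then show ?thesis using gradient_eqI by metis
qed

lemma bounded_of_compact_support:
  fixes f :: "'a::euclidean_space \<Rightarrow> 'b::real_normed_vector"
  assumes "continuous_on UNIV f" "compact S" "\<And>x. x \<notin> S \<Longrightarrow> f x = 0"
  obtains B where "0 \<le> B" "\<And>x. norm (f x) \<le> B"
proof -
  have "bounded (f ` S)"
    using assms(1,2) by (intro compact_imp_bounded compact_continuous_image) (auto intro: continuous_on_subset)
  then obtain B where "0 < B" "\<And>x. x \<in> S \<Longrightarrow> norm (f x) \<le> B"
    by (auto simp: bounded_pos)
  then show ?thesis using that[of B] assms(3) by (metis less_imp_le norm_zero)
qed

lemma C1_compact_support_continuous:
  assumes "C1_compact_support \<phi>"
  shows "continuous_on UNIV \<phi>"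
  using assms unfolding C1_compact_support_def
  by (meson continuous_at_imp_continuous_on differentiable_imp_continuous_within)

lemma C1_compact_support_bounds:
  fixes \<phi> :: "'a::euclidean_space \<Rightarrow> real"
  assumes "C1_compact_support \<phi>"
  obtains B where "0 \<le> B" "\<And>x. \<bar>\<phi> x\<bar> \<le> B" "\<And>x. norm (gradient \<phi> x) \<le> B"
proof -
  let ?S = "closure {x. \<phi> x \<noteq> 0}"
  have S: "compact ?S" and cont: "continuous_on UNIV \<phi>" "continuous_on UNIV (gradient \<phi>)"
    using assms C1_compact_support_continuous[OF assms] by (simp_all add: C1_compact_support_def)
  have 0: "\<phi> x = 0" if "x \<notin> ?S" for x
    using that closure_subset[of "{x. \<phi> x \<noteq> 0}"] by auto
  have 1: "gradient \<phi> x = 0" if "x \<notin> ?S" for x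
  proof (rule gradient_eqI)
    \<comment> \<open>Off the closed support the function agrees with 0 on an open set, so the
      derivative of 0 transfers.\<close>
    have "((\<lambda>_. 0) has_derivative (\<lambda>v. v \<bullet> 0)) (at x)" by simp
    then have "(\<phi> has_derivative (\<lambda>v. v \<bullet> 0)) (at x)"
    proof (rule has_derivative_transform_within_open)
      show "open (- ?S)" by (rule open_Compl[OF closed_closure])
      show "x \<in> - ?S" using that by simp
      show "0 = \<phi> y" if "y \<in> - ?S" for y using 0[of y] that by simp
    qed
    then show "GDERIV \<phi> x :> 0" by (simp add: gderiv_def)
  qed
  obtain A where "0 \<le> A" "\<And>x. norm (\<phi> x) \<le> A"
    using bounded_of_compact_support[OF cont(1) S 0] by blast
  moreover obtain B where "0 \<le> B" "\<And>x. norm (gradient \<phi> x) \<le> B"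
    using bounded_of_compact_support[OF cont(2) S 1] by blast
  ultimately show ?thesis using that[of "max A B"] by (simp add: le_max_iff_disj)
qed

text \<open>The joint law of \<open>X\<close> and \<open>Y\<close> is a coupling, so its cost bounds
  the infimum. That cost is finite, which is what allows the passage through
  \<open>enn2real\<close>.\<close>

lemma wasserstein2_distr_le:
  fixes X Y :: "'b \<Rightarrow> 'a::euclidean_space"
  assumes "prob_space \<mu>" and [measurable]: "X \<in> borel_measurable \<mu>" "Y \<in> borel_measurable \<mu>"
    and int: "integrable \<mu> (\<lambda>x. (dist (X x) (Y x))\<^sup>2)"
  shows "wasserstein2 (distr \<mu> borel X) (distr \<mu> borel Y) \<le> sqrt (LINT x|\<mu>. (dist (X x) (Y x))\<^sup>2)"
proof -
  interpret prob_space \<mu> by fact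
  let ?\<gamma> = "distr \<mu> (borel \<Otimes>\<^sub>M borel) (\<lambda>x. (X x, Y x))"
  have "?\<gamma> \<in> couplings (distr \<mu> borel X) (distr \<mu> borel Y)"
    by (auto simp: couplings_def distr_distr comp_def intro!: prob_space_distr)
  then have "(INF \<gamma>\<in>couplings (distr \<mu> borel X) (distr \<mu> borel Y).
        \<integral>\<^sup>+z. ennreal ((dist (fst z) (snd z))\<^sup>2) \<partial>\<gamma>)
      \<le> (\<integral>\<^sup>+z. ennreal ((dist (fst z) (snd z))\<^sup>2) \<partial>?\<gamma>)"
    by (rule INF_lower)
  also have "\<dots> = (\<integral>\<^sup>+x. ennreal ((dist (X x) (Y x))\<^sup>2) \<partial>\<mu>)"
    by (subst nn_integral_distr) auto
  also have "\<dots> = ennreal (LINT x|\<mu>. (dist (X x) (Y x))\<^sup>2)"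
    by (rule nn_integral_eq_integral[OF int]) simp
  finally show ?thesis
    unfolding wasserstein2_def by (intro real_sqrt_le_mono enn2real_leI) auto
qed

text \<open>Fubini, with the linear bound in \<open>x\<close> as integrable majorant: finite first
  moment in space, bounded interval in time.\<close>

lemma swap_time_space:
  fixes F :: "real \<Rightarrow> 'a::euclidean_space \<Rightarrow> real" and \<mu> :: "'a measure"
  assumes "prob_space \<mu>" and sets [measurable_cong]: "sets \<mu> = sets borel"
    and int: "integrable \<mu> norm"
    and cont: "continuous_on ({a..b} \<times> UNIV) (\<lambda>(s, x). F s x)"
    and bound: "\<And>s x. s \<in> {a..b} \<Longrightarrow> \<bar>F s x\<bar> \<le> c * (1 + norm x)"
  shows "(LINT s:{a..b}|lborel. LINT x|\<mu>. F s x) = (LINT x|\<mu>. (LINT s:{a..b}|lborel. F s x))"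
proof -
  interpret \<mu>: prob_space \<mu> by fact
  interpret pair_sigma_finite lborel \<mu> ..
  define f where "f s x = indicator {a..b} s * F s x" for s x
  define g where "g s x = indicator {a..b} s * (c * (1 + norm x))" for s :: real and x :: 'a
  have int': "integrable \<mu> (\<lambda>x. c * (1 + norm x))"
    using int by auto
  have g: "integrable (lborel \<Otimes>\<^sub>M \<mu>) (\<lambda>(s, x). g s x)"
  proof (rule Fubini_integrable)
    show "(\<lambda>(s, x). g s x) \<in> borel_measurable (lborel \<Otimes>\<^sub>M \<mu>)"
      unfolding g_def by measurable
    have "(LINT x|\<mu>. norm (g s x)) = indicator {a..b} s * (LINT x|\<mu>. norm (c * (1 + norm x)))" for s
      by (simp add: g_def abs_mult)
    moreover have "integrable lborel (indicator {a..b} :: real \<Rightarrow> real)"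
      by (auto simp: emeasure_lborel_Icc_eq intro!: integrable_real_indicator)
    ultimately show "integrable lborel (\<lambda>s. LINT x|\<mu>. norm (case (s, x) of (s, x) \<Rightarrow> g s x))"
      by simp
    show "AE s in lborel. integrable \<mu> (\<lambda>x. case (s, x) of (s, x) \<Rightarrow> g s x)"
      using int' by (simp add: g_def)
  qed
  \<comment> \<open>Joint measurability follows from continuity on the closed strip; cutting off
    with the indicator removes the uncontrolled values of \<open>F\<close> at other times.\<close>
  have meas: "(\<lambda>(s, x). f s x) \<in> borel_measurable (lborel \<Otimes>\<^sub>M \<mu>)"
  proof -
    have "(\<lambda>p. indicator ({a..b} \<times> UNIV) p *\<^sub>R (case p of (s, x) \<Rightarrow> F s x))
        \<in> borel_measurable (borel :: (real \<times> 'a) measure)"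
      by (intro borel_measurable_continuous_on_indicator cont borel_closed closed_Times) auto
    moreover have "(\<lambda>p. indicator ({a..b} \<times> UNIV) p *\<^sub>R (case p of (s, x) \<Rightarrow> F s x))
        = (\<lambda>(s, x). f s x)"
      by (auto simp: f_def indicator_def)
    moreover have "sets (lborel \<Otimes>\<^sub>M \<mu>) = sets (borel :: (real \<times> 'a) measure)"
    proof -
      have "sets (lborel \<Otimes>\<^sub>M \<mu>) = sets ((borel :: real measure) \<Otimes>\<^sub>M (borel :: 'a measure))"
        by (rule sets_pair_measure_cong[OF sets_lborel sets])
      then show ?thesis by (simp only: borel_prod)
    qed
    ultimately show ?thesis using measurable_cong_sets by metis
  qed
  have "integrable (lborel \<Otimes>\<^sub>M \<mu>) (\<lambda>(s, x). f s x)"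
  proof (rule Bochner_Integration.integrable_bound[OF g meas])
    have "norm (f s x) \<le> norm (g s x)" for s x
      using bound[of s x] by (auto simp: f_def g_def indicator_def intro: order_trans abs_ge_self)
    then show "AE p in lborel \<Otimes>\<^sub>M \<mu>. norm (case p of (s, x) \<Rightarrow> f s x) \<le> norm (case p of (s, x) \<Rightarrow> g s x)"
      by auto
  qed
  then have "(LINT x|\<mu>. LINT s|lborel. f s x) = (LINT s|lborel. LINT x|\<mu>. f s x)"
    by (rule Fubini_integral)
  then show ?thesis
    by (simp add: f_def set_lebesgue_integral_def)
qed

section \<open>The velocity field\<close>

text \<open>\<open>\<mu>\<close> is the initial measure and stays fixed; the unknown is the map
  transporting it. \<open>V_lip\<close> is the exponentiated form of a local Lipschitz bound for
  \<open>ln V\<close> with linearly growing constant, a form common to both exponents of the kernel.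
  It is one-sided, but exchanging \<open>w\<close> and \<open>w'\<close> gives the other
  side.\<close>

locale mollified_flow = prob_space \<mu>
  for \<mu> :: "'a::euclidean_space measure" +
  fixes V :: "'a \<Rightarrow> real" and K :: real
  assumes sets_mu [measurable_cong]: "sets \<mu> = sets borel"
    and second_moment: "integrable \<mu> (\<lambda>x. (norm x)\<^sup>2)"
    and V_pos: "0 < V w"
    and V_cont: "continuous_on UNIV V"
    and V_lip: "V w' * exp (- (K * dist w w' * (1 + norm w + norm w'))) \<le> V w"
    and V_antimono: "norm w \<le> norm w' \<Longrightarrow> V w' \<le> V w"
    and K_nonneg: "0 \<le> K"
    and grad_measurable [measurable]: "gradient V \<in> borel_measurable borel"
    and grad_odd: "gradient V (- w) = - gradient V w"
    and grad_integrable: "integrable lborel (\<lambda>w. (1 + norm w)\<^sup>2 * norm (gradient V w))"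
begin

section \<open>The smoothed density and the regularity of its logarithm\<close>

lemma V_measurable [measurable]: "V \<in> borel_measurable borel"
  using V_cont by (rule borel_measurable_continuous_onI)

lemma V_le: "V w \<le> V 0"
  by (rule V_antimono) simp

text \<open>The constant \<open>C\<close> is explicit so that all maps sharing it have common
  dominating functions.\<close>

definition admissible :: "real \<Rightarrow> ('a \<Rightarrow> 'a) \<Rightarrow> bool" where
  "admissible C X \<longleftrightarrow> 0 \<le> C \<and> X \<in> borel_measurable borel \<and> (\<forall>x. norm (X x) \<le> C * (1 + norm x))"

text \<open>This is the convolution of \<open>V\<close> with the image of \<open>\<mu>\<close> under
  \<open>X\<close>, pulled back to \<open>\<mu>\<close>; see
  \<open>conv_measure_distr\<close>.\<close>

definition dens :: "('a \<Rightarrow> 'a) \<Rightarrow> 'a \<Rightarrow> real" where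
  "dens X y = (LINT x|\<mu>. V (y - X x))"

definition mom :: "('a \<Rightarrow> 'a) \<Rightarrow> real" where
  "mom X = (LINT x|\<mu>. norm (X x))"

text \<open>The sign makes this the transport velocity: the equation says that the time derivative
  of the density plus the divergence of density times \<open>vel\<close> is 0.\<close>

definition vel :: "('a \<Rightarrow> 'a) \<Rightarrow> 'a \<Rightarrow> 'a" where
  "vel X z = - conv_vec (gradient V) (\<lambda>y. ln (dens X y)) z"

lemma admissible_measurable:
  assumes "admissible C X"
  shows "X \<in> borel_measurable borel"
  using assms by (simp add: admissible_def)

lemma admissible_bound:
  assumes "admissible C X"
  shows "norm (X x) \<le> C * (1 + norm x)"
  using assms by (simp add: admissible_def)

lemma integrable_norm_mu: "integrable \<mu> norm"
proof (rule Bochner_Integration.integrable_bound)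
  show "integrable \<mu> (\<lambda>x. 1 + (norm x)\<^sup>2)"
    using second_moment by auto
  have "t \<le> 1 + t\<^sup>2" for t :: real
    using zero_le_power2[of "t - 1/2"] by (simp add: power2_eq_square algebra_simps)
  then show "AE x in \<mu>. norm (norm x) \<le> norm (1 + (norm x)\<^sup>2)"
    by (auto simp: abs_of_nonneg)
qed simp

lemma integrable_square_affine:
  assumes "0 \<le> c"
  shows "integrable \<mu> (\<lambda>x. (1 + c * (1 + norm x))\<^sup>2)"
proof -
  have "(\<lambda>x::'a. (1 + c * (1 + norm x))\<^sup>2)
      = (\<lambda>x. (1 + c)\<^sup>2 + 2 * (1 + c) * c * norm x + c\<^sup>2 * (norm x)\<^sup>2)"
    by (auto simp: power2_eq_square algebra_simps)
  then show ?thesis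
    using integrable_norm_mu second_moment by (auto intro!: Bochner_Integration.integrable_add)
qed

lemma admissible_integrable:
  assumes "admissible C X"
  shows "integrable \<mu> (\<lambda>x. norm (X x))"
proof (rule Bochner_Integration.integrable_bound)
  note [measurable] = admissible_measurable[OF assms]
  show "(\<lambda>x. norm (X x)) \<in> borel_measurable \<mu>" by measurable
  show "integrable \<mu> (\<lambda>x. C * (1 + norm x))"
    using integrable_norm_mu by auto
  show "AE x in \<mu>. norm (norm (X x)) \<le> norm (C * (1 + norm x))"
    using admissible_bound[OF assms] by (auto intro: order_trans abs_ge_self)
qed

lemma mom_nonneg: "0 \<le> mom X"
  by (simp add: mom_def)

lemma dens_integrable:
  assumes "admissible C X"
  shows "integrable \<mu> (\<lambda>x. V (y - X x))"
proof (rule integrable_const_bound[where B = "V 0"])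
  note [measurable] = admissible_measurable[OF assms]
  show "(\<lambda>x. V (y - X x)) \<in> borel_measurable \<mu>" by measurable
  show "AE x in \<mu>. norm (V (y - X x)) \<le> V 0"
    using V_le V_pos by (simp add: less_imp_le)
qed

lemma dens_le:
  assumes "admissible C X"
  shows "dens X y \<le> V 0"
proof -
  have "dens X y \<le> (LINT x|\<mu>. V 0)"
    unfolding dens_def using dens_integrable[OF assms] V_le by (intro integral_mono) auto
  then show ?thesis by (simp add: prob_space)
qed

text \<open>The tangent inequality \<open>exp t \<ge> 1 + t\<close> at the mean plays the role of Jensen's inequality.\<close>

lemma dens_lower:
  assumes "admissible C X"
  defines "S \<equiv> (LINT x|\<mu>. (1 + C * (1 + norm x))\<^sup>2)"
  shows "V 0 * exp (- (K * S * (1 + norm y)\<^sup>2)) \<le> dens X y"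
proof -
  note [measurable] = admissible_measurable[OF assms(1)]
  have C: "0 \<le> C" using assms(1) by (simp add: admissible_def)
  define A where "A = K * S * (1 + norm y)\<^sup>2"
  define g where "g x = K * (1 + norm y)\<^sup>2 * (1 + C * (1 + norm x))\<^sup>2" for x :: 'a
  have g: "integrable \<mu> g" "(LINT x|\<mu>. g x) = A"
    using integrable_square_affine[OF C]
    by (auto simp: g_def[abs_def] A_def S_def mult.assoc mult.left_commute[of S] mult.commute[of S])
  have "V 0 * exp (- A) * (1 - (g x - A)) \<le> V (y - X x)" for x
  proof -
    let ?s = "norm (y - X x)"
    have s: "1 + ?s \<le> (1 + norm y) * (1 + C * (1 + norm x))"
      using norm_diff_le_one_plus[of y "X x"] admissible_bound[OF assms(1), of x]
      by (smt (verit) mult_left_mono norm_ge_zero)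
    have "?s * (1 + ?s) \<le> (1 + ?s)\<^sup>2" by (simp add: power2_eq_square mult_right_mono)
    also have "\<dots> \<le> ((1 + norm y) * (1 + C * (1 + norm x)))\<^sup>2"
      using s by (intro power_mono) auto
    finally have "K * (?s * (1 + ?s)) \<le> g x"
      unfolding g_def using K_nonneg by (simp add: power_mult_distrib mult.assoc mult_left_mono)
    then have "V 0 * exp (- g x) \<le> V 0 * exp (- (K * ?s * (1 + ?s)))"
      using V_pos[of 0] by (simp add: mult.assoc)
    also have "\<dots> \<le> V (y - X x)"
      using V_lip[of 0 "y - X x"] by simp
    finally have 1: "V 0 * exp (- g x) \<le> V (y - X x)" .
    have "1 - (g x - A) \<le> exp (- (g x - A))"
      using exp_ge_add_one_self[of "- (g x - A)"] by linarith
    then have "V 0 * exp (- A) * (1 - (g x - A)) \<le> V 0 * exp (- A) * exp (- (g x - A))"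
      using V_pos[of 0] by simp
    also have "\<dots> = V 0 * exp (- g x)"
      by (simp add: mult.assoc flip: exp_add)
    finally show ?thesis using 1 by simp
  qed
  then have "(LINT x|\<mu>. V 0 * exp (- A) * (1 - (g x - A))) \<le> dens X y"
    unfolding dens_def using g dens_integrable[OF assms(1)] by (intro integral_mono) auto
  also have "(LINT x|\<mu>. V 0 * exp (- A) * (1 - (g x - A))) = V 0 * exp (- A)"
    using g by (simp add: prob_space)
  finally show ?thesis by (simp add: A_def)
qed

lemma dens_pos:
  assumes "admissible C X"
  shows "0 < dens X y"
  using dens_lower[OF assms, of y] V_pos[of 0] by (smt (verit) exp_gt_zero mult_pos_pos)

text \<open>The upper side is \<open>dens_le\<close>, the lower side \<open>dens_lower\<close>. The
  bound sees \<open>X\<close> only through \<open>C\<close>, so it can serve as a majorant along a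
  whole sequence of maps.\<close>

lemma ln_dens_bound:
  assumes "admissible C X"
  shows "\<bar>ln (dens X y)\<bar>
    \<le> (\<bar>ln (V 0)\<bar> + K * (LINT x|\<mu>. (1 + C * (1 + norm x))\<^sup>2)) * (1 + norm y)\<^sup>2"
proof -
  let ?S = "LINT x|\<mu>. (1 + C * (1 + norm x))\<^sup>2"
  have "ln (V 0 * exp (- (K * ?S * (1 + norm y)\<^sup>2))) \<le> ln (dens X y)"
    using dens_lower[OF assms, of y] V_pos[of 0] dens_pos[OF assms] by (subst ln_le_cancel_iff) auto
  then have 1: "ln (V 0) - K * ?S * (1 + norm y)\<^sup>2 \<le> ln (dens X y)"
    using V_pos[of 0] by (simp add: ln_mult)
  have 2: "ln (dens X y) \<le> ln (V 0)"
    using dens_le[OF assms] dens_pos[OF assms] V_pos by simp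
  have 3: "\<bar>ln (V 0)\<bar> * 1 \<le> \<bar>ln (V 0)\<bar> * (1 + norm y)\<^sup>2"
    by (intro mult_left_mono) auto
  have "0 \<le> K * ?S * (1 + norm y)\<^sup>2" using K_nonneg by simp
  with 1 2 3 show ?thesis by (simp add: algebra_simps)
qed

text \<open>Because \<open>V\<close> is radially decreasing, \<open>V (a - X x)\<close> and \<open>norm (a - X x)\<close> are negatively
  correlated (Chebyshev), so tilting \<open>\<mu>\<close> by \<open>V (a - X x)\<close> does not increase the mean distance
  to \<open>a\<close>.\<close>

lemma dens_ratio:
  fixes a b :: 'a
  assumes "admissible C X"
  defines "m \<equiv> (LINT x|\<mu>. norm (a - X x))"
  shows "dens X a * exp (- (K * dist a b * (1 + 2 * m + dist a b))) \<le> dens X b"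
proof -
  note [measurable] = admissible_measurable[OF assms(1)]
  define r where "r x = norm (a - X x)" for x
  define d where "d = dist a b"
  define c where "c = exp (- (K * d * (1 + 2 * m + d)))"
  have rint: "integrable \<mu> r"
    unfolding r_def
  proof (rule Bochner_Integration.integrable_bound)
    show "integrable \<mu> (\<lambda>x. norm a + norm (X x))"
      using admissible_integrable[OF assms(1)] by auto
    show "AE x in \<mu>. norm (norm (a - X x)) \<le> norm (norm a + norm (X x))"
      by (auto intro: norm_triangle_ineq4)
  qed measurable
  have rm: "(LINT x|\<mu>. r x) = m" by (simp add: m_def r_def)
  have m0: "0 \<le> m" by (simp add: m_def)
  have d0: "0 \<le> d" by (simp add: d_def)
  \<comment> \<open>Monotonicity of \<open>V\<close> is stated through norms of vectors, so a vector
    on the sphere of radius \<open>m\<close> stands for the value of the radial profile at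
    \<open>m\<close>.\<close>
  obtain w :: 'a where w: "norm w = m"
    using m0 by (metis vector_choose_size)
  have Vint: "integrable \<mu> (\<lambda>x. V (a - X x))"
    by (rule dens_integrable[OF assms(1)])
  \<comment> \<open>Outside radius \<open>m\<close> the value of \<open>V\<close> is smaller and the
    factor nonnegative; inside, \<open>V\<close> is larger and the factor negative. After
    integration the right side vanishes, since \<open>m\<close> is the mean of
    \<open>r\<close>.\<close>
  have cheb: "V (a - X x) * (r x - m) \<le> V w * (r x - m)" for x
  proof (cases "m \<le> r x")
    case True
    then show ?thesis using V_antimono[of w "a - X x"] w by (simp add: r_def mult_right_mono)
  next
    case False
    then show ?thesis using V_antimono[of "a - X x" w] w by (simp add: r_def mult_right_mono_neg)
  qed
  have prodint: "integrable \<mu> (\<lambda>x. V (a - X x) * (r x - m))"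
  proof (rule Bochner_Integration.integrable_bound)
    show "integrable \<mu> (\<lambda>x. V 0 * \<bar>r x - m\<bar>)" using rint by auto
    show "(\<lambda>x. V (a - X x) * (r x - m)) \<in> borel_measurable \<mu>"
      unfolding r_def by measurable
    show "AE x in \<mu>. norm (V (a - X x) * (r x - m)) \<le> norm (V 0 * \<bar>r x - m\<bar>)"
      using V_pos V_le by (auto simp: abs_mult less_imp_le intro!: mult_mono)
  qed
  have "(LINT x|\<mu>. V (a - X x) * (r x - m)) \<le> (LINT x|\<mu>. V w * (r x - m))"
    using prodint rint cheb by (intro integral_mono) auto
  also have "\<dots> = 0" using rint rm by (simp add: prob_space)
  finally have neg: "(LINT x|\<mu>. V (a - X x) * (r x - m)) \<le> 0" .
  \<comment> \<open>The Lipschitz factor at \<open>x\<close> equals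
    \<open>c * exp (- (2 * K * d * (r x - m)))\<close>. Replacing the last exponential by its
    tangent at \<open>r x = m\<close> leaves an expression affine in \<open>r x\<close>, whose
    integral involves only the covariance in \<open>neg\<close>.\<close>
  have pt: "c * (V (a - X x) - 2 * K * d * (V (a - X x) * (r x - m))) \<le> V (b - X x)" for x
  proof -
    have "norm (b - X x) \<le> r x + d"
      unfolding r_def d_def dist_norm
      by (metis add.commute diff_add_cancel add_diff_eq norm_triangle_ineq norm_minus_commute)
    then have "K * d * (1 + norm (b - X x) + r x) \<le> K * d * (1 + 2 * r x + d)"
      using K_nonneg d0 by (intro mult_left_mono) auto
    then have "V (a - X x) * exp (- (K * d * (1 + 2 * r x + d)))
        \<le> V (a - X x) * exp (- (K * d * (1 + norm (b - X x) + r x)))"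
      using V_pos by (simp add: less_imp_le)
    also have "\<dots> \<le> V (b - X x)"
      using V_lip[of "a - X x" "b - X x"] by (simp add: r_def d_def dist_norm norm_minus_commute)
    finally have 1: "V (a - X x) * exp (- (K * d * (1 + 2 * r x + d))) \<le> V (b - X x)" .
    have "1 - 2 * K * d * (r x - m) \<le> exp (- (2 * K * d * (r x - m)))"
      using exp_ge_add_one_self[of "- (2 * K * d * (r x - m))"] by simp
    then have "c * V (a - X x) * (1 - 2 * K * d * (r x - m))
        \<le> c * V (a - X x) * exp (- (2 * K * d * (r x - m)))"
      using V_pos[of "a - X x"] by (intro mult_left_mono) (auto simp: c_def)
    also have "\<dots> = V (a - X x) * exp (- (K * d * (1 + 2 * r x + d)))"
      by (simp add: c_def algebra_simps flip: exp_add)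
    finally show ?thesis using 1 by (simp add: algebra_simps)
  qed
  \<comment> \<open>The covariance is nonpositive and enters with a minus sign, so dropping it only
    lowers the value.\<close>
  have "c * dens X a \<le> c * (dens X a - 2 * K * d * (LINT x|\<mu>. V (a - X x) * (r x - m)))"
    using neg K_nonneg d0 by (intro mult_left_mono) (auto simp: c_def mult_nonneg_nonpos)
  also have "\<dots> = (LINT x|\<mu>. c * (V (a - X x) - 2 * K * d * (V (a - X x) * (r x - m))))"
    using Vint prodint by (simp add: dens_def)
  also have "\<dots> \<le> dens X b"
    unfolding dens_def using Vint prodint dens_integrable[OF assms(1)] pt by (intro integral_mono) auto
  finally show ?thesis by (simp add: c_def d_def mult.commute)
qed

text \<open>\<open>dens_ratio\<close> in both directions. The mean distance to \<open>a\<close> is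
  at most \<open>norm a + mom X\<close>, and bounding twice this plus \<open>dist a b\<close> yields
  the factor 3. The constant \<open>C\<close> does not enter, only the first moment; this lets the
  growth estimate of the scheme close.\<close>

lemma ln_dens_lip:
  assumes "admissible C X"
  shows "\<bar>ln (dens X a) - ln (dens X b)\<bar> \<le> 3 * K * dist a b * (1 + norm a + norm b + mom X)"
proof -
  note [measurable] = admissible_measurable[OF assms(1)]
  have *: "ln (dens X a) - ln (dens X b) \<le> 3 * K * dist a b * (1 + norm a + norm b + mom X)" for a b
  proof -
    define m where "m = (LINT x|\<mu>. norm (a - X x))"
    let ?d = "dist a b"
    have "m \<le> (LINT x|\<mu>. norm a + norm (X x))"
      unfolding m_def
    proof (rule integral_mono')
      show "integrable \<mu> (\<lambda>x. norm a + norm (X x))"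
        using admissible_integrable[OF assms(1)] by auto
    qed (auto intro: norm_triangle_ineq4)
    also have "\<dots> = norm a + mom X"
      using admissible_integrable[OF assms(1)] by (simp add: mom_def prob_space)
    finally have m: "m \<le> norm a + mom X" .
    have d: "?d \<le> norm a + norm b" by (simp add: dist_norm norm_triangle_ineq4)
    have "ln (dens X a * exp (- (K * ?d * (1 + 2 * m + ?d)))) \<le> ln (dens X b)"
      using dens_ratio[OF assms, of a b, folded m_def] dens_pos[OF assms] by (subst ln_le_cancel_iff) auto
    then have "ln (dens X a) - ln (dens X b) \<le> K * ?d * (1 + 2 * m + ?d)"
      using dens_pos[OF assms, of a] by (simp add: ln_mult)
    also have "\<dots> \<le> K * ?d * (3 * (1 + norm a + norm b + mom X))"
    proof (rule mult_left_mono)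
      show "1 + 2 * m + ?d \<le> 3 * (1 + norm a + norm b + mom X)"
        using m d mom_nonneg[of X] norm_ge_zero[of a] norm_ge_zero[of b] by argo
    qed (use K_nonneg in simp)
    finally show ?thesis by (simp add: algebra_simps)
  qed
  show ?thesis using *[of a b] *[of b a] by (simp add: dist_commute algebra_simps abs_le_iff)
qed

lemma continuous_ln_dens:
  assumes "admissible C X"
  shows "continuous_on UNIV (\<lambda>y. ln (dens X y))"
proof -
  have "((\<lambda>y. ln (dens X y)) \<longlongrightarrow> ln (dens X a)) (at a)" for a
  proof (rule Lim_null_comparison[THEN LIM_zero_cancel])
    show "\<forall>\<^sub>F y in at a. norm (ln (dens X y) - ln (dens X a))
        \<le> 3 * K * dist y a * (1 + norm y + norm a + mom X)"
      using ln_dens_lip[OF assms] by simp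
    show "((\<lambda>y. 3 * K * dist y a * (1 + norm y + norm a + mom X)) \<longlongrightarrow> 0) (at a)"
      by (rule tendsto_eq_intros refl | simp)+
  qed
  then show ?thesis by (simp add: continuous_on_def)
qed

lemma ln_dens_measurable:
  assumes "admissible C X"
  shows "(\<lambda>y. ln (dens X y)) \<in> borel_measurable borel"
  using continuous_ln_dens[OF assms] by (rule borel_measurable_continuous_onI)

section \<open>Growth and local Lipschitz bounds for the velocity\<close>

lemma vel_reflect:
  assumes "admissible C X"
  shows "vel X z = - (LINT u|lborel. ln (dens X (z - u)) *\<^sub>R gradient V u)"
proof -
  note [measurable] = ln_dens_measurable[OF assms]
  show ?thesis
    \<comment> \<open>The reflection moves \<open>z\<close> from \<open>gradient V\<close> into the
      logarithm, so that variations in \<open>z\<close> are measured by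
      \<open>ln_dens_lip\<close>.\<close>
    unfolding vel_def conv_vec_def
    using integral_reflect_lborel[of "\<lambda>u. ln (dens X (z - u)) *\<^sub>R gradient V u" z] by simp
qed

text \<open>The variables \<open>z\<close> and \<open>u\<close> are separated in the majorant, which
  is therefore uniform for bounded \<open>z\<close> and for all maps with the same
  \<open>C\<close>.\<close>

lemma vel_integrand_bound:
  assumes "admissible C X"
  shows "norm (ln (dens X (z - u)) *\<^sub>R gradient V u)
    \<le> (\<bar>ln (V 0)\<bar> + K * (LINT x|\<mu>. (1 + C * (1 + norm x))\<^sup>2)) * (1 + norm z)\<^sup>2
      * ((1 + norm u)\<^sup>2 * norm (gradient V u))"
proof -
  let ?A = "\<bar>ln (V 0)\<bar> + K * (LINT x|\<mu>. (1 + C * (1 + norm x))\<^sup>2)"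
  have "(1 + norm (z - u))\<^sup>2 \<le> ((1 + norm z) * (1 + norm u))\<^sup>2"
    using norm_diff_le_one_plus by (intro power_mono) auto
  then have "?A * (1 + norm (z - u))\<^sup>2 \<le> ?A * ((1 + norm z)\<^sup>2 * (1 + norm u)\<^sup>2)"
    using K_nonneg by (intro mult_left_mono) (auto simp: power_mult_distrib)
  then have "\<bar>ln (dens X (z - u))\<bar> \<le> ?A * ((1 + norm z)\<^sup>2 * (1 + norm u)\<^sup>2)"
    using ln_dens_bound[OF assms, of "z - u"] by linarith
  then show ?thesis
    using mult_right_mono[OF _ norm_ge_zero[of "gradient V u"]] by (fastforce simp: mult.assoc)
qed

lemma vel_integrable:
  assumes "admissible C X"
  shows "integrable lborel (\<lambda>u. ln (dens X (z - u)) *\<^sub>R gradient V u)"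
proof (rule Bochner_Integration.integrable_bound)
  note [measurable] = ln_dens_measurable[OF assms]
  let ?A = "\<bar>ln (V 0)\<bar> + K * (LINT x|\<mu>. (1 + C * (1 + norm x))\<^sup>2)"
  show "integrable lborel (\<lambda>u. ?A * (1 + norm z)\<^sup>2 * ((1 + norm u)\<^sup>2 * norm (gradient V u)))"
    using grad_integrable by (rule integrable_mult_right)
  show "(\<lambda>u. ln (dens X (z - u)) *\<^sub>R gradient V u) \<in> borel_measurable lborel"
    by measurable
  show "AE u in lborel. norm (ln (dens X (z - u)) *\<^sub>R gradient V u)
      \<le> norm (?A * (1 + norm z)\<^sup>2 * ((1 + norm u)\<^sup>2 * norm (gradient V u)))"
    using vel_integrand_bound[OF assms, of z] by (auto intro: order_trans[OF _ abs_ge_self])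
qed

text \<open>The factor 6 is the 3 of \<open>ln_dens_lip\<close> times the 2 lost when norms at
  \<open>z - u\<close> are replaced by norms at \<open>z\<close> and the weight in
  \<open>u\<close>.\<close>

definition \<Lambda> :: real where
  "\<Lambda> = 6 * K * (LINT w|lborel. (1 + norm w)\<^sup>2 * norm (gradient V w))"

lemma Lambda_nonneg: "0 \<le> \<Lambda>"
  using K_nonneg by (simp add: \<Lambda>_def)

lemma grad_integrable': "integrable lborel (gradient V)"
proof (rule Bochner_Integration.integrable_bound[OF grad_integrable])
  have "1 * norm (gradient V w) \<le> (1 + norm w)\<^sup>2 * norm (gradient V w)" for w
    by (intro mult_right_mono) auto
  then show "AE w in lborel. norm (gradient V w) \<le> norm ((1 + norm w)\<^sup>2 * norm (gradient V w))"
    by simp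
qed simp

lemma grad_integral_zero: "(LINT u|lborel. gradient V u) = 0"
proof -
  have "(LINT u|lborel. gradient V u) = (LINT u|lborel. gradient V (0 - u))"
    by (rule integral_reflect_lborel[symmetric]) simp
  also have "\<dots> = - (LINT u|lborel. gradient V u)"
    by (simp add: grad_odd)
  finally show ?thesis
    by (simp add: eq_neg_iff_add_eq_0 flip: scaleR_2)
qed

lemma norm_integral_grad_le:
  fixes f :: "'a \<Rightarrow> real"
  assumes "integrable lborel (\<lambda>u. f u *\<^sub>R gradient V u)"
    and "\<And>u. \<bar>f u\<bar> \<le> 6 * K * c * (1 + norm u)\<^sup>2"
  shows "norm (LINT u|lborel. f u *\<^sub>R gradient V u) \<le> \<Lambda> * c"
proof -
  have "norm (LINT u|lborel. f u *\<^sub>R gradient V u) \<le> (LINT u|lborel. norm (f u *\<^sub>R gradient V u))"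
    by (rule integral_norm_bound)
  also have "\<dots> \<le> (LINT u|lborel. 6 * K * c * ((1 + norm u)\<^sup>2 * norm (gradient V u)))"
  proof (rule integral_mono)
    show "norm (f u *\<^sub>R gradient V u) \<le> 6 * K * c * ((1 + norm u)\<^sup>2 * norm (gradient V u))" for u
      using mult_right_mono[OF assms(2)[of u], of "norm (gradient V u)"] by (simp add: mult.assoc)
    show "integrable lborel (\<lambda>u. norm (f u *\<^sub>R gradient V u))"
      using assms(1) by (rule integrable_norm)
  qed (use grad_integrable in auto)
  also have "\<dots> = \<Lambda> * c" by (simp add: \<Lambda>_def)
  finally show ?thesis .
qed

text \<open>Estimating the integrand directly gives quadratic growth only; since \<open>gradient V\<close> has mean
  zero, \<open>ln (dens X z)\<close> may be subtracted, and the Lipschitz bound saves one power.\<close>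

lemma vel_growth:
  assumes "admissible C X"
  shows "norm (vel X z) \<le> \<Lambda> * (1 + norm z + mom X)"
proof -
  let ?f = "\<lambda>u. ln (dens X (z - u)) - ln (dens X z)"
  have int: "integrable lborel (\<lambda>u. ?f u *\<^sub>R gradient V u)"
    unfolding scaleR_diff_left
    using vel_integrable[OF assms, of z] grad_integrable' by auto
  have "vel X z = - (LINT u|lborel. ?f u *\<^sub>R gradient V u)"
    unfolding scaleR_diff_left vel_reflect[OF assms]
    using vel_integrable[OF assms, of z] grad_integrable' grad_integral_zero by simp
  moreover have "\<bar>?f u\<bar> \<le> 6 * K * (1 + norm z + mom X) * (1 + norm u)\<^sup>2" for u
  proof -
    have "\<bar>?f u\<bar> \<le> 3 * K * (norm u * (1 + norm (z - u) + norm z + mom X))"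
      using ln_dens_lip[OF assms, of "z - u" z] by (simp add: dist_norm mult.assoc)
    also have "\<dots> \<le> 3 * K * ((1 + norm u) * (2 * (1 + norm z + mom X) * (1 + norm u)))"
    proof (intro mult_left_mono mult_mono)
      have "0 \<le> norm z * norm u" "0 \<le> mom X * norm u"
        using mom_nonneg[of X] by auto
      then show "1 + norm (z - u) + norm z + mom X \<le> 2 * (1 + norm z + mom X) * (1 + norm u)"
        unfolding ring_distribs
        using mom_nonneg[of X] norm_triangle_ineq4[of z u] norm_ge_zero[of u] by linarith
    qed (use K_nonneg mom_nonneg[of X] in auto)
    finally show ?thesis by (simp add: power2_eq_square algebra_simps)
  qed
  ultimately show ?thesis using norm_integral_grad_le[OF int, of "1 + norm z + mom X"] by simp
qed

text \<open>Here the integrand is already a difference of logarithms, so nothing has to be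
  subtracted. The Lipschitz constant grows linearly in the two points, hence the bound is only
  local.\<close>

lemma vel_lip:
  assumes "admissible C X"
  shows "norm (vel X z - vel X z') \<le> \<Lambda> * (dist z z' * (1 + norm z + norm z' + mom X))"
proof -
  let ?f = "\<lambda>u. ln (dens X (z - u)) - ln (dens X (z' - u))"
  have int: "integrable lborel (\<lambda>u. ?f u *\<^sub>R gradient V u)"
    unfolding scaleR_diff_left
    using vel_integrable[OF assms, of z] vel_integrable[OF assms, of z'] by auto
  have "vel X z - vel X z' = - (LINT u|lborel. ?f u *\<^sub>R gradient V u)"
    unfolding scaleR_diff_left vel_reflect[OF assms]
    using vel_integrable[OF assms, of z] vel_integrable[OF assms, of z'] by simp
  moreover have "\<bar>?f u\<bar> \<le> 6 * K * (dist z z' * (1 + norm z + norm z' + mom X)) * (1 + norm u)\<^sup>2" for u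
  proof -
    have "\<bar>?f u\<bar> \<le> 3 * K * dist z z' * (1 + norm (z - u) + norm (z' - u) + mom X)"
      using ln_dens_lip[OF assms, of "z - u" "z' - u"] by (simp add: dist_norm)
    also have "\<dots> \<le> 3 * K * dist z z' * (2 * (1 + norm z + norm z' + mom X) * (1 + norm u)\<^sup>2)"
    proof (intro mult_left_mono)
      have "0 \<le> norm z * norm u" "0 \<le> norm z' * norm u" "0 \<le> mom X * norm u"
        using mom_nonneg[of X] by auto
      then have "1 + norm (z - u) + norm (z' - u) + mom X
          \<le> 2 * (1 + norm z + norm z' + mom X) * (1 + norm u)"
        unfolding ring_distribs
        using mom_nonneg[of X] norm_triangle_ineq4[of z u] norm_triangle_ineq4[of z' u]
          norm_ge_zero[of z] norm_ge_zero[of z'] by linarith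
      also have "\<dots> \<le> 2 * (1 + norm z + norm z' + mom X) * (1 + norm u)\<^sup>2"
        using mom_nonneg[of X]
        by (intro mult_left_mono self_le_power) auto
      finally show "1 + norm (z - u) + norm (z' - u) + mom X
          \<le> 2 * (1 + norm z + norm z' + mom X) * (1 + norm u)\<^sup>2" .
    qed (use K_nonneg in auto)
    finally show ?thesis by (simp add: algebra_simps)
  qed
  ultimately show ?thesis
    using norm_integral_grad_le[OF int, of "dist z z' * (1 + norm z + norm z' + mom X)"] by simp
qed

section \<open>Continuity of the velocity in the map and the point\<close>

lemma dens_tendsto:
  assumes "\<And>n. admissible C (X n)" "admissible C Y" "\<And>x. (\<lambda>n. X n x) \<longlonglongrightarrow> Y x"
    and "z \<longlonglongrightarrow> z0"
  shows "(\<lambda>n. dens (X n) (z n)) \<longlonglongrightarrow> dens Y z0"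
  unfolding dens_def
proof (rule integral_dominated_convergence[where w = "\<lambda>_. V 0"])
  have [measurable]: "X n \<in> borel_measurable borel" "Y \<in> borel_measurable borel" for n
    using assms admissible_measurable by blast+
  show "(\<lambda>x. V (z0 - Y x)) \<in> borel_measurable \<mu>" "(\<lambda>x. V (z n - X n x)) \<in> borel_measurable \<mu>" for n
    by measurable
  show "AE x in \<mu>. (\<lambda>n. V (z n - X n x)) \<longlonglongrightarrow> V (z0 - Y x)"
    using V_cont assms(3,4)
    by (auto intro!: isCont_tendsto_compose[where g = V] tendsto_diff simp: continuous_on_eq_continuous_at)
  show "AE x in \<mu>. norm (V (z n - X n x)) \<le> V 0" for n
    using V_le V_pos by (simp add: less_imp_le)
qed simp

text \<open>Two nested dominated convergences, against \<open>\<mu>\<close> inside the logarithm and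
  against Lebesgue measure outside. The common \<open>C\<close> and the boundedness of
  \<open>z\<close> supply the outer majorant; pointwise convergence of the maps is enough.\<close>

lemma vel_tendsto:
  assumes "\<And>n. admissible C (X n)" "admissible C Y" "\<And>x. (\<lambda>n. X n x) \<longlonglongrightarrow> Y x"
    and "z \<longlonglongrightarrow> z0"
  shows "(\<lambda>n. vel (X n) (z n)) \<longlonglongrightarrow> vel Y z0"
proof -
  let ?A = "\<bar>ln (V 0)\<bar> + K * (LINT x|\<mu>. (1 + C * (1 + norm x))\<^sup>2)"
  obtain B where B: "\<And>n. norm (z n) \<le> B"
    using assms(4) by (metis convergentI convergent_imp_Bseq BseqE)
  have [measurable]: "(\<lambda>y. ln (dens (X n) y)) \<in> borel_measurable borel"
    "(\<lambda>y. ln (dens Y y)) \<in> borel_measurable borel" for n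
    using ln_dens_measurable assms by blast+
  have "(\<lambda>n. LINT u|lborel. ln (dens (X n) (z n - u)) *\<^sub>R gradient V u)
      \<longlonglongrightarrow> (LINT u|lborel. ln (dens Y (z0 - u)) *\<^sub>R gradient V u)"
  proof (rule integral_dominated_convergence
      [where w = "\<lambda>u. ?A * (1 + B)\<^sup>2 * ((1 + norm u)\<^sup>2 * norm (gradient V u))"])
    show "integrable lborel (\<lambda>u. ?A * (1 + B)\<^sup>2 * ((1 + norm u)\<^sup>2 * norm (gradient V u)))"
      using grad_integrable by (rule integrable_mult_right)
    show "AE u in lborel. (\<lambda>n. ln (dens (X n) (z n - u)) *\<^sub>R gradient V u)
        \<longlonglongrightarrow> ln (dens Y (z0 - u)) *\<^sub>R gradient V u"
      using dens_pos[OF assms(2)]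
      by (auto intro!: tendsto_scaleR tendsto_ln dens_tendsto[OF assms(1-3)] tendsto_diff assms(4)
          simp: less_imp_neq[symmetric])
    show "AE u in lborel. norm (ln (dens (X n) (z n - u)) *\<^sub>R gradient V u)
        \<le> ?A * (1 + B)\<^sup>2 * ((1 + norm u)\<^sup>2 * norm (gradient V u))" for n
    proof (rule AE_I2, rule order_trans[OF vel_integrand_bound[OF assms(1)]])
      fix u
      show "?A * (1 + norm (z n))\<^sup>2 * ((1 + norm u)\<^sup>2 * norm (gradient V u))
          \<le> ?A * (1 + B)\<^sup>2 * ((1 + norm u)\<^sup>2 * norm (gradient V u))"
        using K_nonneg B[of n]
        by (intro mult_right_mono mult_left_mono power_mono) auto
    qed
  qed measurable
  then show ?thesis
    by (simp add: vel_reflect[OF assms(1)] vel_reflect[OF assms(2)] tendsto_minus)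
qed

lemma vel_measurable:
  assumes "admissible C X"
  shows "vel X \<in> borel_measurable borel"
proof -
  have "isCont (vel X) z" for z
    unfolding continuous_at_sequentially comp_def
    using vel_tendsto[of C "\<lambda>_. X" X] assms by simp
  then show ?thesis
    by (intro borel_measurable_continuous_onI) (simp add: continuous_at_imp_continuous_on)
qed

section \<open>The Euler scheme\<close>

text \<open>The recursion runs over maps, not over points: the velocity at a step depends on the
  positions of all particles at once.\<close>

primrec euler :: "real \<Rightarrow> nat \<Rightarrow> 'a \<Rightarrow> 'a" where
  "euler h 0 = (\<lambda>x. x)"
| "euler h (Suc k) = (\<lambda>x. euler h k x + h *\<^sub>R vel (euler h k) (euler h k x))"

text \<open>The Gronwall constant up to time \<open>T\<close>: the rate comes from
  \<open>euler_growth_pow\<close>, the factor from the first moment of \<open>\<mu>\<close>.\<close>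

definition growth :: "real \<Rightarrow> real" where
  "growth T = exp (3 * \<Lambda> * T) * (1 + mom (\<lambda>x. x))"

lemma growth_ge_0: "0 \<le> growth T"
  using mom_nonneg by (simp add: growth_def)

lemma mom_add_le:
  assumes "admissible C X" "0 \<le> c"
    and "\<And>x. norm (Y x) \<le> norm (X x) + c * (1 + norm (X x) + mom X)"
  shows "mom Y \<le> mom X + c * (1 + 2 * mom X)"
proof -
  note int = admissible_integrable[OF assms(1)]
  have "mom Y \<le> (LINT x|\<mu>. norm (X x) + c * (1 + norm (X x) + mom X))"
    unfolding mom_def[of Y]
  proof (rule integral_mono')
    show "0 \<le> norm (X x) + c * (1 + norm (X x) + mom X)" for x
      using assms(2) mom_nonneg by simp
  qed (use int assms(3) in auto)
  also have "\<dots> = mom X + c * (1 + 2 * mom X)"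
    using int by (simp add: prob_space flip: mom_def)
  finally show ?thesis .
qed

text \<open>The sum of position and moment is tracked because neither closes alone. A step adds at
  most \<open>h * \<Lambda>\<close> times \<open>1 + norm + mom\<close> to the position and
  \<open>h * \<Lambda>\<close> times \<open>1 + 2 * mom\<close> to the moment, together at most 3
  times the tracked sum. Measurability joins the induction because \<open>vel\<close> of an iterate
  is known to be measurable once the iterate is admissible.\<close>

lemma euler_growth_pow:
  assumes "0 \<le> h"
  shows "euler h k \<in> borel_measurable borel \<and>
    (\<forall>x. 1 + norm (euler h k x) + mom (euler h k)
      \<le> (1 + 3 * h * \<Lambda>) ^ k * (1 + norm x + mom (\<lambda>x. x)))"
proof (induction k)
  case (Suc k)
  let ?E = "euler h k" and ?m0 = "mom (\<lambda>x. x)" and ?q = "1 + 3 * h * \<Lambda>"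
  have q: "1 \<le> ?q" using assms Lambda_nonneg by simp
  have "admissible (?q ^ k * (1 + ?m0)) ?E"
    unfolding admissible_def
  proof (intro conjI allI)
    fix x
    have "norm (?E x) \<le> ?q ^ k * (1 + norm x + ?m0)"
      using Suc mom_nonneg[of ?E] by (smt (verit))
    also have "\<dots> \<le> ?q ^ k * ((1 + ?m0) * (1 + norm x))"
      using q mom_nonneg by (intro mult_left_mono) (auto simp: algebra_simps)
    finally show "norm (?E x) \<le> ?q ^ k * (1 + ?m0) * (1 + norm x)" by (simp add: mult.assoc)
  qed (use Suc q mom_nonneg in auto)
  note adm = this
  note [measurable] = Suc[THEN conjunct1] vel_measurable[OF adm]
  have step: "norm (euler h (Suc k) x) \<le> norm (?E x) + (h * \<Lambda>) * (1 + norm (?E x) + mom ?E)" for x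
  proof -
    have "norm (h *\<^sub>R vel ?E (?E x)) \<le> h * (\<Lambda> * (1 + norm (?E x) + mom ?E))"
      using vel_growth[OF adm, of "?E x"] assms by (simp add: mult_left_mono)
    then show ?thesis
      using norm_triangle_ineq[of "?E x" "h *\<^sub>R vel ?E (?E x)"] by (simp add: mult.assoc)
  qed
  have hL: "0 \<le> h * \<Lambda>" using assms Lambda_nonneg by simp
  have mom: "mom (euler h (Suc k)) \<le> mom ?E + (h * \<Lambda>) * (1 + 2 * mom ?E)"
    by (rule mom_add_le[OF adm hL step])
  have "1 + norm (euler h (Suc k) x) + mom (euler h (Suc k)) \<le> ?q ^ Suc k * (1 + norm x + ?m0)" for x
  proof -
    have "1 + norm (euler h (Suc k) x) + mom (euler h (Suc k))
        \<le> 1 + norm (?E x) + mom ?E + (h * \<Lambda>) * (2 + norm (?E x) + 3 * mom ?E)"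
      using step[of x] mom by (simp add: algebra_simps)
    also have "\<dots> \<le> 1 + norm (?E x) + mom ?E + (h * \<Lambda>) * (3 * (1 + norm (?E x) + mom ?E))"
      using hL by (intro add_left_mono mult_left_mono) auto
    also have "\<dots> = ?q * (1 + norm (?E x) + mom ?E)" by (simp add: algebra_simps)
    also have "\<dots> \<le> ?q * (?q ^ k * (1 + norm x + ?m0))"
      using Suc q by (intro mult_left_mono) auto
    finally show ?thesis by simp
  qed
  moreover have "euler h (Suc k) \<in> borel_measurable borel" by simp
  ultimately show ?case by blast
qed simp

lemma euler_growth:
  assumes "0 \<le> h" "real k * h \<le> T"
  shows "1 + norm (euler h k x) + mom (euler h k) \<le> growth T * (1 + norm x)"
proof -
  let ?m0 = "mom (\<lambda>x. x)"
  have "1 + norm (euler h k x) + mom (euler h k)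
      \<le> (1 + h * (3 * \<Lambda>)) ^ k * (1 + norm x + ?m0)"
    using euler_growth_pow[OF assms(1), of k] by (simp add: mult.left_commute mult.commute)
  also have "\<dots> \<le> exp (3 * \<Lambda> * T) * ((1 + ?m0) * (1 + norm x))"
    using mom_nonneg assms Lambda_nonneg
    by (intro mult_mono power_one_plus_mult_le_exp) (auto simp: algebra_simps)
  finally show ?thesis by (simp add: growth_def mult.assoc)
qed

lemma euler_admissible:
  assumes "0 \<le> h" "real k * h \<le> T"
  shows "admissible (growth T) (euler h k)"
proof -
  have "norm (euler h k x) \<le> growth T * (1 + norm x)" for x
    using euler_growth[OF assms, of x] mom_nonneg[of "euler h k"] by linarith
  then show ?thesis
    using euler_growth_pow[OF assms(1), of k] growth_ge_0 by (simp add: admissible_def)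
qed

lemma euler_speed:
  assumes "0 \<le> h" "real k * h \<le> T"
  shows "norm (vel (euler h k) (euler h k x)) \<le> \<Lambda> * growth T * (1 + norm x)"
  using vel_growth[OF euler_admissible[OF assms], of "euler h k x"]
    mult_left_mono[OF euler_growth[OF assms, of x] Lambda_nonneg] by (simp add: mult.assoc)

text \<open>Telescoping: each step differs from \<open>h *\<^sub>R v\<close> by at most
  \<open>h * \<eta>\<close>.\<close>

lemma euler_drift:
  assumes "0 \<le> h" "j \<le> k"
    and "\<And>i. j \<le> i \<Longrightarrow> i < k \<Longrightarrow> norm (vel (euler h i) (euler h i x) - v) \<le> \<eta>"
  shows "norm (euler h k x - euler h j x - ((real k - real j) * h) *\<^sub>R v) \<le> (real k - real j) * h * \<eta>"
  using assms(2,3)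
proof (induction k rule: dec_induct)
  case (step k)
  let ?d = "vel (euler h k) (euler h k x) - v"
  have "norm (euler h k x - euler h j x - ((real k - real j) * h) *\<^sub>R v) \<le> (real k - real j) * h * \<eta>"
    using step by simp
  moreover have "norm (h *\<^sub>R ?d) \<le> h * \<eta>"
    using step assms(1) by (simp add: mult_left_mono)
  moreover have "euler h (Suc k) x - euler h j x - ((real (Suc k) - real j) * h) *\<^sub>R v
      = (euler h k x - euler h j x - ((real k - real j) * h) *\<^sub>R v) + h *\<^sub>R ?d"
    by (simp add: algebra_simps)
  moreover have "(real (Suc k) - real j) * h * \<eta> = (real k - real j) * h * \<eta> + h * \<eta>"
    by (simp add: algebra_simps)
  ultimately show ?case by (metis norm_triangle_mono)
qed simp

text \<open>Discrete Gronwall for two trajectories: \<open>euler_growth\<close> bounds the local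
  constant of \<open>vel_lip\<close> along both of them by \<open>L\<close>, independently of
  \<open>h\<close> and of the step.\<close>

lemma euler_lip:
  assumes "0 \<le> h" "real k * h \<le> T"
  shows "dist (euler h k x) (euler h k x')
    \<le> exp (\<Lambda> * (growth T * (2 + norm x + norm x')) * T) * dist x x'"
proof -
  define L where "L = \<Lambda> * (growth T * (2 + norm x + norm x'))"
  have L: "0 \<le> L" using Lambda_nonneg growth_ge_0 by (simp add: L_def)
  have "dist (euler h k x) (euler h k x') \<le> (1 + h * L) ^ k * dist x x'"
    using assms(2)
  proof (induction k)
    case (Suc k)
    let ?E = "euler h k"
    have k: "real k * h \<le> T" using Suc.prems assms(1) by (simp add: algebra_simps)
    have "norm (vel ?E (?E x) - vel ?E (?E x'))
        \<le> \<Lambda> * (dist (?E x) (?E x') * (1 + norm (?E x) + norm (?E x') + mom ?E))"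
      by (rule vel_lip[OF euler_admissible[OF assms(1) k]])
    also have "\<dots> \<le> \<Lambda> * (dist (?E x) (?E x') * (growth T * (2 + norm x + norm x')))"
    proof (intro mult_left_mono)
      have "1 + norm (?E x) + norm (?E x') + mom ?E
          \<le> (1 + norm (?E x) + mom ?E) + (1 + norm (?E x') + mom ?E)"
        using mom_nonneg[of ?E] by simp
      also have "\<dots> \<le> growth T * (1 + norm x) + growth T * (1 + norm x')"
        by (intro add_mono euler_growth assms(1) k)
      finally show "1 + norm (?E x) + norm (?E x') + mom ?E \<le> growth T * (2 + norm x + norm x')"
        by (simp add: algebra_simps)
    qed (use Lambda_nonneg in auto)
    finally have "norm (h *\<^sub>R (vel ?E (?E x) - vel ?E (?E x'))) \<le> h * (L * dist (?E x) (?E x'))"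
      using assms(1) by (simp add: L_def mult_left_mono mult.assoc mult.left_commute mult.commute)
    moreover have "euler h (Suc k) x - euler h (Suc k) x'
        = (?E x - ?E x') + h *\<^sub>R (vel ?E (?E x) - vel ?E (?E x'))"
      by (simp add: algebra_simps)
    ultimately have "dist (euler h (Suc k) x) (euler h (Suc k) x')
        \<le> dist (?E x) (?E x') + h * (L * dist (?E x) (?E x'))"
      unfolding dist_norm by (metis norm_triangle_mono order_refl)
    also have "\<dots> = (1 + h * L) * dist (?E x) (?E x')" by (simp add: algebra_simps)
    also have "\<dots> \<le> (1 + h * L) * ((1 + h * L) ^ k * dist x x')"
      using Suc.IH[OF k] assms(1) L by (intro mult_left_mono) auto
    finally show ?case by (simp add: mult.assoc)
  qed simp
  also have "\<dots> \<le> exp (L * T) * dist x x'"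
    using power_one_plus_mult_le_exp[OF L assms] by (simp add: mult_right_mono)
  finally show ?thesis by (simp add: L_def)
qed

text \<open>Piecewise constant interpolation with step \<open>1 / Suc n\<close>: the value at every
  time is an exact Euler iterate, so estimates for iterates apply without interpolation error, at
  the price of jumps in time.\<close>

definition curve :: "nat \<Rightarrow> real \<Rightarrow> 'a \<Rightarrow> 'a" where
  "curve n t = euler (1 / real (Suc n)) (nat \<lfloor>t * real (Suc n)\<rfloor>)"

lemma curve_index:
  assumes "0 \<le> t"
  shows "real (nat \<lfloor>t * real (Suc n)\<rfloor>) * (1 / real (Suc n)) \<le> t"
    and "t < real (nat \<lfloor>t * real (Suc n)\<rfloor>) * (1 / real (Suc n)) + 1 / real (Suc n)"
proof -
  let ?N = "real (Suc n)"
  have fl: "real (nat \<lfloor>t * ?N\<rfloor>) = of_int \<lfloor>t * ?N\<rfloor>" using assms by simp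
  have "of_int \<lfloor>t * ?N\<rfloor> \<le> t * ?N" "t * ?N < of_int \<lfloor>t * ?N\<rfloor> + 1"
    by linarith+
  then show "real (nat \<lfloor>t * ?N\<rfloor>) * (1 / ?N) \<le> t" "t < real (nat \<lfloor>t * ?N\<rfloor>) * (1 / ?N) + 1 / ?N"
    unfolding fl by (simp_all add: divide_simps del: of_nat_Suc)
qed

lemma curve_0: "curve n 0 = (\<lambda>x. x)"
  by (simp add: curve_def)

lemma curve_admissible:
  assumes "0 \<le> t" "t \<le> T"
  shows "admissible (growth T) (curve n t)"
  unfolding curve_def using curve_index(1)[OF assms(1), of n] assms by (intro euler_admissible) auto

lemma curve_lip:
  assumes "0 \<le> t" "t \<le> T"
  shows "dist (curve n t x) (curve n t x')
    \<le> exp (\<Lambda> * (growth T * (2 + norm x + norm x')) * T) * dist x x'"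
  unfolding curve_def using curve_index(1)[OF assms(1), of n] assms by (intro euler_lip) auto

text \<open>Serves twice: with \<open>v = 0\<close> it bounds displacements, with \<open>v\<close>
  the limit velocity it identifies the derivative. The terms with \<open>1 / real (Suc n)\<close>
  arise because the grid time between the two indices differs from \<open>t - s\<close> by at most
  one step.\<close>

lemma curve_drift:
  assumes "0 \<le> s" "s \<le> t" "0 \<le> \<eta>"
    and "\<And>u. s \<le> u \<Longrightarrow> u \<le> t \<Longrightarrow> norm (vel (curve n u) (curve n u x) - v) \<le> \<eta>"
  shows "norm (curve n t x - curve n s x - (t - s) *\<^sub>R v)
    \<le> (t - s + 1 / real (Suc n)) * \<eta> + 1 / real (Suc n) * norm v"
proof -
  define h where "h = 1 / real (Suc n)"
  define j k where "j = nat \<lfloor>s * real (Suc n)\<rfloor>" and "k = nat \<lfloor>t * real (Suc n)\<rfloor>"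
  have h: "0 < h" by (simp add: h_def)
  have jk: "real j * h \<le> s" "s < real j * h + h" "real k * h \<le> t" "t < real k * h + h"
    using curve_index[of s n] curve_index[of t n] assms by (simp_all add: j_def k_def h_def)
  have "j \<le> k"
    unfolding j_def k_def using assms by (intro nat_mono floor_mono mult_right_mono) auto
  have "norm (euler h k x - euler h j x - ((real k - real j) * h) *\<^sub>R v) \<le> (real k - real j) * h * \<eta>"
  proof (rule euler_drift)
    fix i assume i: "j \<le> i" "i < k"
    show "norm (vel (euler h i) (euler h i x) - v) \<le> \<eta>"
    proof (cases "i = j")
      \<comment> \<open>The grid time of index \<open>j\<close> may lie before \<open>s\<close>,
        where the hypothesis says nothing; but the curve has the same value at
        \<open>s\<close>.\<close>
      case True
      then show ?thesis using assms(4)[of s] assms(2) by (simp add: curve_def h_def j_def)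
    next
      case False
      then have "real j + 1 \<le> real i" "real i \<le> real k" using i by linarith+
      then have "(real j + 1) * h \<le> real i * h" "real i * h \<le> real k * h"
        using h by (intro mult_right_mono; simp)+
      then have "s \<le> real i * h" "real i * h \<le> t" using jk unfolding distrib_right by linarith+
      moreover have "curve n (real i * h) = euler h i"
        by (simp add: curve_def h_def del: of_nat_Suc)
      ultimately show ?thesis using assms(4)[of "real i * h"] by simp
    qed
  qed (use h \<open>j \<le> k\<close> in auto)
  also have "\<dots> \<le> (t - s + h) * \<eta>"
    using jk assms(3) by (intro mult_right_mono) (auto simp: algebra_simps)
  finally have 1: "norm (euler h k x - euler h j x - ((real k - real j) * h) *\<^sub>R v) \<le> (t - s + h) * \<eta>" .
  have "\<bar>(real k - real j) * h - (t - s)\<bar> \<le> h"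
    using jk by (simp add: algebra_simps abs_le_iff)
  then have "norm (((real k - real j) * h - (t - s)) *\<^sub>R v) \<le> h * norm v"
    by (simp add: mult_right_mono)
  moreover have "curve n t x - curve n s x - (t - s) *\<^sub>R v
      = (euler h k x - euler h j x - ((real k - real j) * h) *\<^sub>R v) + ((real k - real j) * h - (t - s)) *\<^sub>R v"
    by (simp add: curve_def h_def j_def k_def algebra_simps)
  ultimately have "norm (curve n t x - curve n s x - (t - s) *\<^sub>R v) \<le> (t - s + h) * \<eta> + h * norm v"
    using 1 by (metis norm_triangle_mono)
  then show ?thesis by (simp add: h_def)
qed

lemma curve_time:
  assumes "0 \<le> s" "s \<le> T" "0 \<le> t" "t \<le> T"
  shows "dist (curve n t x) (curve n s x) \<le> (\<bar>t - s\<bar> + 1 / real (Suc n)) * (\<Lambda> * growth T * (1 + norm x))"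
proof -
  have *: "dist (curve n t x) (curve n s x) \<le> (t - s + 1 / real (Suc n)) * (\<Lambda> * growth T * (1 + norm x))"
    if "0 \<le> s" "s \<le> t" "t \<le> T" for s t
  proof -
    have "norm (vel (curve n u) (curve n u x) - 0) \<le> \<Lambda> * growth T * (1 + norm x)"
      if "s \<le> u" "u \<le> t" for u
      unfolding curve_def diff_zero
      using that \<open>0 \<le> s\<close> \<open>t \<le> T\<close> curve_index(1)[of u n] by (intro euler_speed) auto
    then have "norm (curve n t x - curve n s x - (t - s) *\<^sub>R 0)
        \<le> (t - s + 1 / real (Suc n)) * (\<Lambda> * growth T * (1 + norm x)) + 1 / real (Suc n) * norm (0::'a)"
      using that Lambda_nonneg growth_ge_0 by (intro curve_drift) auto
    then show ?thesis by (simp add: dist_norm)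
  qed
  show ?thesis
    using *[of s t] *[of t s] assms by (cases "s \<le> t") (auto simp: dist_commute)
qed

lemma curve_subsequence:
  assumes "0 \<le> T"
  obtains \<sigma> X where "strict_mono \<sigma>"
    "\<And>t x. 0 \<le> t \<Longrightarrow> t \<le> T \<Longrightarrow> (\<lambda>n. curve (\<sigma> n) t x) \<longlonglongrightarrow> X t x"
proof -
  let ?S = "{0..T} \<times> (UNIV :: 'a set)"
  obtain \<sigma> :: "nat \<Rightarrow> nat" and g where g: "strict_mono \<sigma>"
    "\<And>p. p \<in> ?S \<Longrightarrow> (\<lambda>n. (case p of (t, x) \<Rightarrow> curve (\<sigma> n) t x)) \<longlonglongrightarrow> g p"
  proof (rule asymptotically_equicontinuous_subsequence[of ?S "\<lambda>n (t, x). curve n t x"])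
    fix p assume "p \<in> ?S"
    then obtain t x where p: "p = (t, x)" "0 \<le> t" "t \<le> T" by auto
    then have "norm (curve n t x) \<le> growth T * (1 + norm x) + 1" for n
      using admissible_bound[OF curve_admissible[of t T n], of x] by simp
    moreover have "0 < growth T * (1 + norm x) + 1"
      using growth_ge_0[of T] by (simp add: add_nonneg_pos)
    ultimately show "\<exists>c>0. \<forall>n. norm (case p of (t, x) \<Rightarrow> curve n t x) \<le> c"
      using p by auto
  next
    fix p :: "real \<times> 'a" and e :: real assume "p \<in> ?S" "0 < e"
    then obtain t x where p: "p = (t, x)" "0 \<le> t" "t \<le> T" by auto
    \<comment> \<open>\<open>B\<close> and \<open>L\<close> are moduli in time and in space near
      \<open>p\<close>. The 3 and the 2 in \<open>L\<close> come from
      \<open>norm y \<le> norm x + 1\<close>, ensured by \<open>\<delta> \<le> 1\<close>. Time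
      difference, jump and space difference cost \<open>e / 4\<close> each, so the total stays
      strictly below \<open>e\<close>.\<close>
    define B where "B = \<Lambda> * growth T * (1 + norm x) + 1"
    define L where "L = exp (\<Lambda> * (growth T * (3 + 2 * norm x)) * T)"
    have B: "0 < B" using Lambda_nonneg growth_ge_0[of T] by (simp add: B_def add_nonneg_pos)
    have L: "0 < L" by (simp add: L_def)
    define \<delta> where "\<delta> = min 1 (min (e / (4 * B)) (e / (4 * L)))"
    have \<delta>: "0 < \<delta>" "\<delta> \<le> 1" "\<delta> * B \<le> e / 4" "\<delta> * L \<le> e / 4"
      using B L \<open>0 < e\<close> by (auto simp: \<delta>_def min_def field_simps)
    obtain N where N: "1 / real (Suc N) < e / (4 * B)"
      using B \<open>0 < e\<close> nat_approx_posE[of "e / (4 * B)"] by auto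
    have "dist (curve n t x) (curve n s y) < e"
      if n: "n \<ge> N" and sy: "0 \<le> s" "s \<le> T" and d: "dist (t, x) (s, y) < \<delta>" for n s y
    proof -
      have dt: "\<bar>t - s\<bar> < \<delta>" and dx: "dist x y < \<delta>"
        using d dist_fst_le[of "(t, x)" "(s, y)"] dist_snd_le[of "(t, x)" "(s, y)"]
        by (auto simp: dist_real_def)
      have "1 / real (Suc n) \<le> 1 / real (Suc N)" using n by (simp add: divide_simps)
      then have "1 / real (Suc n) * B \<le> e / (4 * B) * B"
        using N B by (intro mult_right_mono) auto
      then have hn: "1 / real (Suc n) * B \<le> e / 4" using B by simp
      have "dist (curve n t x) (curve n s x) \<le> (\<bar>t - s\<bar> + 1 / real (Suc n)) * B"
        using curve_time[OF sy p(2,3), of n x] Lambda_nonneg growth_ge_0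
        by (smt (verit) B_def mult_left_mono divide_nonneg_nonneg of_nat_0_le_iff)
      also have "\<dots> \<le> \<delta> * B + 1 / real (Suc n) * B"
        using dt B by (simp add: distrib_right mult_right_mono)
      finally have 1: "dist (curve n t x) (curve n s x) \<le> e / 4 + e / 4"
        using hn \<delta>(3) by linarith
      have "norm y \<le> norm x + 1"
        using dx \<delta>(2) norm_triangle_ineq2[of y x] by (simp add: dist_norm norm_minus_commute)
      then have "\<Lambda> * (growth T * (2 + norm x + norm y)) * T \<le> \<Lambda> * (growth T * (3 + 2 * norm x)) * T"
        using Lambda_nonneg growth_ge_0 \<open>0 \<le> T\<close> by (intro mult_left_mono mult_right_mono) auto
      then have "exp (\<Lambda> * (growth T * (2 + norm x + norm y)) * T) * dist x y \<le> L * \<delta>"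
        unfolding L_def using dx by (intro mult_mono) auto
      then have 2: "dist (curve n s x) (curve n s y) \<le> e / 4"
        using curve_lip[OF sy, of n x y] \<delta>(4) by (simp add: mult.commute)
      show ?thesis
        using 1 2 dist_triangle[of "curve n t x" "curve n s y" "curve n s x"] \<open>0 < e\<close> by linarith
    qed
    then show "\<exists>\<delta>>0. \<exists>N. \<forall>n\<ge>N. \<forall>q\<in>?S. dist p q < \<delta> \<longrightarrow>
        dist (case p of (t, x) \<Rightarrow> curve n t x) (case q of (t, x) \<Rightarrow> curve n t x) < e"
      unfolding p(1) using \<delta>(1) by (intro exI[of _ \<delta>] conjI exI[of _ N]) auto
  qed blast
  then show ?thesis
    using that[OF g(1), of "\<lambda>t x. g (t, x)"] by fastforce
qed

section \<open>The limit flow\<close>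

lemma admissible_square_integrable:
  assumes "admissible C X"
  shows "integrable \<mu> (\<lambda>x. (norm (X x))\<^sup>2)"
proof (rule Bochner_Integration.integrable_bound)
  note [measurable] = admissible_measurable[OF assms]
  have C: "0 \<le> C" using assms by (simp add: admissible_def)
  show "integrable \<mu> (\<lambda>x. (1 + C * (1 + norm x))\<^sup>2)"
    using C by (rule integrable_square_affine)
  show "(\<lambda>x. (norm (X x))\<^sup>2) \<in> borel_measurable \<mu>" by measurable
  have "norm (X x) \<le> 1 + C * (1 + norm x)" for x
    using admissible_bound[OF assms, of x] by linarith
  then show "AE x in \<mu>. norm ((norm (X x))\<^sup>2) \<le> norm ((1 + C * (1 + norm x))\<^sup>2)"
    by (auto intro!: power_mono)
qed

lemma distr_in_P2:
  assumes "admissible C X"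
  shows "distr \<mu> borel X \<in> P2"
proof -
  note [measurable] = admissible_measurable[OF assms]
  have "(\<integral>\<^sup>+x. ennreal ((norm x)\<^sup>2) \<partial>distr \<mu> borel X) = (\<integral>\<^sup>+x. ennreal ((norm (X x))\<^sup>2) \<partial>\<mu>)"
    by (rule nn_integral_distr) auto
  also have "\<dots> = ennreal (LINT x|\<mu>. (norm (X x))\<^sup>2)"
    by (rule nn_integral_eq_integral[OF admissible_square_integrable[OF assms]]) simp
  finally show ?thesis
    by (auto simp: P2_def intro!: prob_space_distr)
qed

lemma conv_measure_distr:
  assumes "admissible C X"
  shows "conv_measure V (distr \<mu> borel X) y = dens X y"
proof -
  note [measurable] = admissible_measurable[OF assms]
  show ?thesis
    unfolding conv_measure_def dens_def by (rule integral_distr) measurable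
qed

text \<open>By contradiction, since \<open>vel_tendsto\<close> is purely sequential: bad indices and
  times tending to \<open>r\<close> would give maps converging pointwise to \<open>X r\<close> whose
  velocities stay \<open>\<eta>\<close> away from the limit.\<close>

lemma velocity_uniformly_close:
  assumes \<sigma>: "strict_mono \<sigma>"
    and lim: "\<And>t x. 0 \<le> t \<Longrightarrow> t \<le> T \<Longrightarrow> (\<lambda>n. curve (\<sigma> n) t x) \<longlonglongrightarrow> X t x"
    and adm: "admissible (growth T) (X r)"
    and r: "0 \<le> r" "r \<le> T" and "0 < \<eta>"
  shows "\<exists>\<delta>>0. \<exists>N. \<forall>n\<ge>N. \<forall>u. 0 \<le> u \<and> u \<le> T \<and> \<bar>u - r\<bar> < \<delta> \<longrightarrow>
    norm (vel (curve (\<sigma> n) u) (curve (\<sigma> n) u x) - vel (X r) (X r x)) \<le> \<eta>"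
proof (rule ccontr)
  assume contr: "\<not> ?thesis"
  have "\<exists>n\<ge>k. \<exists>u. 0 \<le> u \<and> u \<le> T \<and> \<bar>u - r\<bar> < 1 / real (Suc k) \<and>
      \<eta> < norm (vel (curve (\<sigma> n) u) (curve (\<sigma> n) u x) - vel (X r) (X r x))" for k
  proof -
    have "0 < 1 / real (Suc k)" by simp
    then show ?thesis using contr by (meson not_le)
  qed
  then obtain n u where nu: "\<And>k. n k \<ge> k" "\<And>k. 0 \<le> u k" "\<And>k. u k \<le> T"
    "\<And>k. \<bar>u k - r\<bar> < 1 / real (Suc k)"
    "\<And>k. \<eta> < norm (vel (curve (\<sigma> (n k)) (u k)) (curve (\<sigma> (n k)) (u k) x) - vel (X r) (X r x))"
    by metis
  define Y where "Y k = curve (\<sigma> (n k)) (u k)" for k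
  have Yadm: "admissible (growth T) (Y k)" for k
    unfolding Y_def using nu by (intro curve_admissible)
  have n_top: "filterlim n at_top sequentially"
    using nu(1) by (intro filterlim_at_top_mono[OF filterlim_ident]) auto
  \<comment> \<open>The times vary with \<open>k\<close>, so \<open>Y k\<close> is compared with the
    curve at the fixed time \<open>r\<close>; \<open>curve_time\<close> makes the difference
    vanish.\<close>
  have Y: "(\<lambda>k. Y k y) \<longlonglongrightarrow> X r y" for y
  proof (rule Lim_transform)
    show "(\<lambda>k. curve (\<sigma> (n k)) r y) \<longlonglongrightarrow> X r y"
      using filterlim_compose[OF lim[OF r] n_top] .
    let ?B = "\<Lambda> * growth T * (1 + norm y)"
    have B: "0 \<le> ?B" using Lambda_nonneg growth_ge_0 by simp
    show "(\<lambda>k. Y k y - curve (\<sigma> (n k)) r y) \<longlonglongrightarrow> 0"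
    proof (rule Lim_null_comparison)
      show "\<forall>\<^sub>F k in sequentially. norm (Y k y - curve (\<sigma> (n k)) r y) \<le> 2 * ?B * (1 / real (Suc k))"
      proof (rule always_eventually, rule allI)
        fix k
        have "k \<le> \<sigma> (n k)" using nu(1)[of k] seq_suble[OF \<sigma>, of "n k"] by linarith
        then have "1 / real (Suc (\<sigma> (n k))) \<le> 1 / real (Suc k)" by (simp add: divide_simps)
        then have "(\<bar>u k - r\<bar> + 1 / real (Suc (\<sigma> (n k)))) * ?B \<le> (2 * (1 / real (Suc k))) * ?B"
          using nu(4)[of k] B by (intro mult_right_mono) auto
        then show "norm (Y k y - curve (\<sigma> (n k)) r y) \<le> 2 * ?B * (1 / real (Suc k))"
          using curve_time[OF r nu(2)[of k] nu(3)[of k], of "\<sigma> (n k)" y] by (simp add: Y_def dist_norm mult_ac)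
      qed
      show "(\<lambda>k. 2 * ?B * (1 / real (Suc k))) \<longlonglongrightarrow> 0"
        by (rule tendsto_mult_right_zero[OF LIMSEQ_Suc[OF lim_1_over_n]])
    qed
  qed
  have "\<forall>\<^sub>F k in sequentially. dist (vel (Y k) (Y k x)) (vel (X r) (X r x)) < \<eta>"
    using vel_tendsto[OF Yadm adm Y Y] \<open>0 < \<eta>\<close> by (rule tendstoD)
  then obtain k where "norm (vel (Y k) (Y k x) - vel (X r) (X r x)) < \<eta>"
    by (auto simp: eventually_sequentially dist_norm)
  then show False using nu(5)[of k] by (simp add: Y_def)
qed

lemma flow_exists:
  assumes "0 \<le> T"
  obtains X where "X 0 = (\<lambda>x. x)"
    "\<And>t. t \<in> {0..T} \<Longrightarrow> admissible (growth T) (X t)"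
    "\<And>s t x. s \<in> {0..T} \<Longrightarrow> t \<in> {0..T} \<Longrightarrow>
      dist (X s x) (X t x) \<le> \<bar>s - t\<bar> * (\<Lambda> * growth T * (1 + norm x))"
    "continuous_on ({0..T} \<times> UNIV) (\<lambda>(t, x). X t x)"
    "\<And>t x. t \<in> {0..T} \<Longrightarrow> norm (vel (X t) (X t x)) \<le> \<Lambda> * growth T * (1 + norm x)"
    "\<And>t x. t \<in> {0..T} \<Longrightarrow>
      ((\<lambda>s. X s x) has_vector_derivative vel (X t) (X t x)) (at t within {0..T})"
proof -
  obtain \<sigma> X where \<sigma>: "strict_mono \<sigma>"
    and lim: "\<And>t x. 0 \<le> t \<Longrightarrow> t \<le> T \<Longrightarrow> (\<lambda>n. curve (\<sigma> n) t x) \<longlonglongrightarrow> X t x"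
    using curve_subsequence[OF assms] by blast
  have h0: "(\<lambda>n. 1 / real (Suc (\<sigma> n))) \<longlonglongrightarrow> 0"
    using LIMSEQ_subseq_LIMSEQ[OF LIMSEQ_Suc[OF lim_1_over_n] \<sigma>] by (simp add: comp_def)
  have X0: "X 0 = (\<lambda>x. x)"
  proof
    fix x
    have "(\<lambda>n. curve (\<sigma> n) 0 x) \<longlonglongrightarrow> x" by (simp add: curve_0)
    then show "X 0 x = x" using lim[of 0 x] assms LIMSEQ_unique by blast
  qed
  have adm: "admissible (growth T) (X t)" if t: "t \<in> {0..T}" for t
    unfolding admissible_def
  proof (intro conjI allI)
    have c: "admissible (growth T) (curve (\<sigma> n) t)" for n
      using t by (intro curve_admissible) auto
    show "X t \<in> borel_measurable borel"
      by (rule borel_measurable_LIMSEQ_metric[of "\<lambda>n. curve (\<sigma> n) t"])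
        (use admissible_measurable[OF c] lim t in auto)
    show "norm (X t x) \<le> growth T * (1 + norm x)" for x
      by (rule LIMSEQ_le_const2[OF tendsto_norm[OF lim]]) (use t admissible_bound[OF c] in auto)
  qed (rule growth_ge_0)
  have time: "dist (X s x) (X t x) \<le> \<bar>s - t\<bar> * (\<Lambda> * growth T * (1 + norm x))"
    if "s \<in> {0..T}" "t \<in> {0..T}" for s t x
  proof (rule LIMSEQ_le)
    show "(\<lambda>n. dist (curve (\<sigma> n) s x) (curve (\<sigma> n) t x)) \<longlonglongrightarrow> dist (X s x) (X t x)"
      using that by (intro tendsto_dist lim) auto
    show "(\<lambda>n. (\<bar>s - t\<bar> + 1 / real (Suc (\<sigma> n))) * (\<Lambda> * growth T * (1 + norm x)))
        \<longlonglongrightarrow> \<bar>s - t\<bar> * (\<Lambda> * growth T * (1 + norm x))"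
      by (rule tendsto_eq_intros h0 refl | simp)+
    show "\<exists>N. \<forall>n\<ge>N. dist (curve (\<sigma> n) s x) (curve (\<sigma> n) t x)
        \<le> (\<bar>s - t\<bar> + 1 / real (Suc (\<sigma> n))) * (\<Lambda> * growth T * (1 + norm x))"
      using that curve_time[of t T s] by auto
  qed
  \<comment> \<open>Pointwise limits inherit the Lipschitz bound in space; together with
    \<open>time\<close> it yields joint continuity.\<close>
  have lip: "dist (X t x) (X t y) \<le> exp (\<Lambda> * (growth T * (2 + norm x + norm y)) * T) * dist x y"
    if "t \<in> {0..T}" for t x y
    by (rule LIMSEQ_le_const2[OF tendsto_dist[OF lim lim]]) (use that curve_lip in auto)
  have cont: "continuous_on ({0..T} \<times> UNIV) (\<lambda>(t, x). X t x)"
    unfolding continuous_on_def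
  proof (rule ballI)
    fix p :: "real \<times> 'a" assume "p \<in> {0..T} \<times> UNIV"
    then obtain t x where p: "p = (t, x)" and t: "t \<in> {0..T}" by auto
    let ?F = "at (t, x) within {0..T} \<times> UNIV"
    let ?g = "\<lambda>p. \<bar>fst p - t\<bar> * (\<Lambda> * growth T * (1 + norm (snd p)))
      + exp (\<Lambda> * (growth T * (2 + norm (snd p) + norm x)) * T) * dist (snd p) x"
    have fst: "(fst \<longlongrightarrow> t) ?F" and snd: "(snd \<longlongrightarrow> x) ?F"
      using tendsto_fst[OF tendsto_ident_at[of "(t, x)"]] tendsto_snd[OF tendsto_ident_at[of "(t, x)"]]
      by simp_all
    show "((\<lambda>(t, x). X t x) \<longlongrightarrow> (case p of (t, x) \<Rightarrow> X t x)) (at p within {0..T} \<times> UNIV)"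
      unfolding p split_conv
    proof (rule metric_tendsto_imp_tendsto[where f = ?g and a = 0])
      show "(?g \<longlongrightarrow> 0) ?F"
        by (rule tendsto_eq_intros fst snd refl | simp)+
      show "\<forall>\<^sub>F p in ?F. dist (case p of (t, x) \<Rightarrow> X t x) (X t x) \<le> dist (?g p) 0"
        unfolding eventually_at_filter
      proof (rule always_eventually, clarify)
        fix s y assume s: "s \<in> {0..T}"
        have "dist (X s y) (X t x) \<le> dist (X s y) (X t y) + dist (X t y) (X t x)"
          by (rule dist_triangle)
        also have "\<dots> \<le> ?g (s, y)"
          using time[OF s t, of y] lip[OF t, of y x] by simp
        also have "\<dots> \<le> dist (?g (s, y)) 0"
          by simp
        finally show "dist (X s y) (X t x) \<le> dist (?g (s, y)) 0" .
      qed
    qed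
  qed
  have speed: "norm (vel (X t) (X t x)) \<le> \<Lambda> * growth T * (1 + norm x)" if t: "t \<in> {0..T}" for t x
  proof (rule LIMSEQ_le_const2)
    show "(\<lambda>n. norm (vel (curve (\<sigma> n) t) (curve (\<sigma> n) t x))) \<longlonglongrightarrow> norm (vel (X t) (X t x))"
      using t by (intro tendsto_norm vel_tendsto[OF _ adm[OF t]] lim curve_admissible) auto
    have "norm (vel (curve n t) (curve n t x)) \<le> \<Lambda> * growth T * (1 + norm x)" for n
      unfolding curve_def using t curve_index(1)[of t n] by (intro euler_speed) auto
    then show "\<exists>N. \<forall>n\<ge>N. norm (vel (curve (\<sigma> n) t) (curve (\<sigma> n) t x)) \<le> \<Lambda> * growth T * (1 + norm x)"
      by blast
  qed
  have deriv: "((\<lambda>s. X s x) has_vector_derivative vel (X r) (X r x)) (at r within {0..T})"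
    if r: "r \<in> {0..T}" for r x
    unfolding has_vector_derivative_def has_derivative_within_alt2
  proof (intro conjI allI impI)
    let ?v = "vel (X r) (X r x)"
    show "bounded_linear (\<lambda>h. h *\<^sub>R ?v)" by (rule bounded_linear_scaleR_left)
    fix \<eta> :: real assume "0 < \<eta>"
    then obtain \<delta> N where \<delta>: "0 < \<delta>" "\<And>n u. n \<ge> N \<Longrightarrow> 0 \<le> u \<Longrightarrow> u \<le> T \<Longrightarrow> \<bar>u - r\<bar> < \<delta> \<Longrightarrow>
        norm (vel (curve (\<sigma> n) u) (curve (\<sigma> n) u x) - ?v) \<le> \<eta>"
      using velocity_uniformly_close[OF \<sigma> lim adm[OF r], of \<eta> x] r by auto
    \<comment> \<open>In the limit the discretisation terms of \<open>curve_drift\<close> disappear.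
      With one of \<open>s\<close>, \<open>t\<close> equal to \<open>r\<close>, this is the
      definition of the derivative.\<close>
    have *: "norm (X t x - X s x - (t - s) *\<^sub>R ?v) \<le> (t - s) * \<eta>"
      if st: "0 \<le> s" "s \<le> t" "t \<le> T" "\<bar>s - r\<bar> < \<delta>" "\<bar>t - r\<bar> < \<delta>" for s t
    proof (rule LIMSEQ_le)
      show "(\<lambda>n. norm (curve (\<sigma> n) t x - curve (\<sigma> n) s x - (t - s) *\<^sub>R ?v))
          \<longlonglongrightarrow> norm (X t x - X s x - (t - s) *\<^sub>R ?v)"
        using st by (intro tendsto_norm tendsto_diff lim tendsto_const) auto
      show "(\<lambda>n. (t - s + 1 / real (Suc (\<sigma> n))) * \<eta> + 1 / real (Suc (\<sigma> n)) * norm ?v)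
          \<longlonglongrightarrow> (t - s) * \<eta>"
        by (rule tendsto_eq_intros h0 refl | simp)+
      show "\<exists>N. \<forall>n\<ge>N. norm (curve (\<sigma> n) t x - curve (\<sigma> n) s x - (t - s) *\<^sub>R ?v)
          \<le> (t - s + 1 / real (Suc (\<sigma> n))) * \<eta> + 1 / real (Suc (\<sigma> n)) * norm ?v"
      proof (intro exI[of _ N] allI impI curve_drift)
        fix n u assume "N \<le> n" "s \<le> u" "u \<le> t"
        then show "norm (vel (curve (\<sigma> n) u) (curve (\<sigma> n) u x) - ?v) \<le> \<eta>"
          using st by (intro \<delta>(2)) auto
      qed (use st \<open>0 < \<eta>\<close> in auto)
    qed
    show "\<forall>\<^sub>F y in at r within {0..T}. norm (X y x - X r x - (y - r) *\<^sub>R ?v) \<le> \<eta> * norm (y - r)"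
      unfolding eventually_at
    proof (intro exI[of _ \<delta>] conjI ballI impI \<delta>(1))
      fix y assume y: "y \<in> {0..T}" "y \<noteq> r \<and> dist y r < \<delta>"
      show "norm (X y x - X r x - (y - r) *\<^sub>R ?v) \<le> \<eta> * norm (y - r)"
      proof (cases "r \<le> y")
        case True
        then show ?thesis
          using *[of r y] y r \<delta>(1) by (simp add: dist_real_def mult.commute)
      next
        case False
        \<comment> \<open>The estimate \<open>*\<close> needs ordered times, so for \<open>y\<close>
          before \<open>r\<close> the increment is reversed.\<close>
        have "X y x - X r x - (y - r) *\<^sub>R ?v = - (X r x - X y x - (r - y) *\<^sub>R ?v)"
          by (simp add: algebra_simps)
        then show ?thesis
          using *[of y r] y r \<delta>(1) False
          by (simp only: norm_minus_cancel) (simp add: dist_real_def mult.commute)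
      qed
    qed
  qed
  show ?thesis
    by (rule that[OF X0 adm time cont speed deriv])
qed

section \<open>From the flow of particles to the weak formulation\<close>

theorem weak_solution_exists:
  assumes "0 \<le> T"
  shows "\<exists>\<rho>. weak_measure_solution V T \<rho> \<and> \<rho> 0 = \<mu>"
proof -
  obtain X where X0: "X 0 = (\<lambda>x. x)"
    and adm: "\<And>t. t \<in> {0..T} \<Longrightarrow> admissible (growth T) (X t)"
    and time: "\<And>s t x. s \<in> {0..T} \<Longrightarrow> t \<in> {0..T} \<Longrightarrow>
      dist (X s x) (X t x) \<le> \<bar>s - t\<bar> * (\<Lambda> * growth T * (1 + norm x))"
    and cont: "continuous_on ({0..T} \<times> UNIV) (\<lambda>(t, x). X t x)"
    and speed: "\<And>t x. t \<in> {0..T} \<Longrightarrow> norm (vel (X t) (X t x)) \<le> \<Lambda> * growth T * (1 + norm x)"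
    and deriv: "\<And>t x. t \<in> {0..T} \<Longrightarrow>
      ((\<lambda>s. X s x) has_vector_derivative vel (X t) (X t x)) (at t within {0..T})"
    using flow_exists[OF assms] by blast
  define \<rho> where "\<rho> t = distr \<mu> borel (X t)" for t
  define B where "B = \<Lambda> * growth T"
  have B: "0 \<le> B" using Lambda_nonneg growth_ge_0 by (simp add: B_def)
  have meas: "X t \<in> borel_measurable \<mu>" if "t \<in> {0..T}" for t
    using admissible_measurable[OF adm[OF that]] by simp
  \<comment> \<open>Joint continuity along the flow gives both the measurability needed for Fubini
    and the continuous integrand for the fundamental theorem of calculus.\<close>
  have cont_vel: "continuous_on ({0..T} \<times> UNIV) (\<lambda>(s, x). vel (X s) (X s x))"
    unfolding continuous_on_sequentially
  proof (intro allI ballI impI, elim conjE)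
    fix q p assume "p \<in> {0..T} \<times> (UNIV :: 'a set)" "\<forall>n. q n \<in> {0..T} \<times> (UNIV :: 'a set)" "q \<longlonglongrightarrow> p"
    then have p: "fst p \<in> {0..T}" and q: "\<And>n. fst (q n) \<in> {0..T}"
      and lim: "(\<lambda>n. fst (q n)) \<longlonglongrightarrow> fst p" "(\<lambda>n. snd (q n)) \<longlonglongrightarrow> snd p"
      by (auto simp: mem_Times_iff intro: tendsto_fst tendsto_snd)
    have *: "(\<lambda>n. X (fst (q n)) (y n)) \<longlonglongrightarrow> X (fst p) z" if "y \<longlonglongrightarrow> z" for y z
      using continuous_on_tendsto_compose[OF cont tendsto_Pair[OF lim(1) that]] p q by simp
    have "(\<lambda>n. vel (X (fst (q n))) (X (fst (q n)) (snd (q n)))) \<longlonglongrightarrow> vel (X (fst p)) (X (fst p) (snd p))"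
      using p q by (intro vel_tendsto[of "growth T"] adm * lim(2) tendsto_const) auto
    then show "((\<lambda>(s, x). vel (X s) (X s x)) \<circ> q) \<longlonglongrightarrow> (case p of (s, x) \<Rightarrow> vel (X s) (X s x))"
      by (simp add: comp_def split_beta)
  qed
  \<comment> \<open>Transporting each particle along its trajectory couples the measures at times
    \<open>s\<close> and \<open>t\<close>. Since particle \<open>x\<close> has speed at most
    \<open>B * (1 + norm x)\<close>, the curve is Lipschitz with constant \<open>B\<close> times the
    norm of \<open>1 + norm x\<close> in the space L2 of \<open>\<mu>\<close>.\<close>
  have "abs_cont_curve P2 wasserstein2 T \<rho>"
    unfolding abs_cont_curve_def
  proof (intro conjI ballI exI[of _ "\<lambda>_. B * sqrt (LINT x|\<mu>. (1 + norm x)\<^sup>2)"] allI impI)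
    show "\<rho> t \<in> P2" if "t \<in> {0..T}" for t
      unfolding \<rho>_def using adm[OF that] by (rule distr_in_P2)
    let ?c = "B * sqrt (LINT x|\<mu>. (1 + norm x)\<^sup>2)"
    show "set_integrable lborel {0..T} (\<lambda>_. ?c)"
      by (intro borel_integrable_atLeastAtMost' continuous_intros)
    fix s t assume st: "0 \<le> s \<and> s \<le> t \<and> t \<le> T"
    then have s: "s \<in> {0..T}" and t: "t \<in> {0..T}" by auto
    note [measurable] = meas[OF s] meas[OF t]
    have sq: "integrable \<mu> (\<lambda>x. ((t - s) * B)\<^sup>2 * (1 + norm x)\<^sup>2)"
    proof -
      have "integrable \<mu> (\<lambda>x. 1 + 2 * norm x + (norm x)\<^sup>2)"
        using integrable_norm_mu second_moment by auto
      then show ?thesis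
        by (simp add: power2_sum add_ac)
    qed
    have le: "(dist (X s x) (X t x))\<^sup>2 \<le> ((t - s) * B)\<^sup>2 * (1 + norm x)\<^sup>2" for x
    proof -
      have "dist (X s x) (X t x) \<le> (t - s) * B * (1 + norm x)"
        using time[OF s t, of x] st by (simp add: B_def mult.assoc)
      then show ?thesis
        unfolding power_mult_distrib[symmetric] by (intro power_mono) auto
    qed
    have int: "integrable \<mu> (\<lambda>x. (dist (X s x) (X t x))\<^sup>2)"
      by (rule Bochner_Integration.integrable_bound[OF sq]) (use le in auto)
    have "wasserstein2 (\<rho> s) (\<rho> t) \<le> sqrt (LINT x|\<mu>. (dist (X s x) (X t x))\<^sup>2)"
      unfolding \<rho>_def using int by (intro wasserstein2_distr_le prob_space_axioms) auto
    also have "\<dots> \<le> sqrt (LINT x|\<mu>. ((t - s) * B)\<^sup>2 * (1 + norm x)\<^sup>2)"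
      using int sq le by (intro real_sqrt_le_mono integral_mono) auto
    also have "\<dots> = (t - s) * ?c"
      using st B by (simp add: real_sqrt_mult abs_mult)
    also have "\<dots> = (LINT r:{s..t}|lborel. ?c)"
      using st by (simp add: set_lebesgue_integral_def)
    finally show "wasserstein2 (\<rho> s) (\<rho> t) \<le> (LINT r:{s..t}|lborel. ?c)" .
  qed
  moreover have "(LINT x|\<rho> t. \<phi> x) - (LINT x|\<rho> 0. \<phi> x) =
      - (LINT s:{0..t}|lborel. LINT x|\<rho> s.
          gradient \<phi> x \<bullet> conv_vec (gradient V) (\<lambda>y. ln (conv_measure V (\<rho> s) y)) x)"
    if \<phi>: "C1_compact_support \<phi>" and t: "t \<in> {0..T}" for \<phi> t
  proof -
    define F where "F s x = gradient \<phi> (X s x) \<bullet> vel (X s) (X s x)" for s x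
    have c\<phi>: "continuous_on UNIV \<phi>" and cg: "continuous_on UNIV (gradient \<phi>)"
      and d\<phi>: "\<And>x. \<phi> differentiable (at x)"
      using \<phi> C1_compact_support_continuous[OF \<phi>] by (simp_all add: C1_compact_support_def)
    have [measurable]: "\<phi> \<in> borel_measurable borel" "gradient \<phi> \<in> borel_measurable borel"
      using c\<phi> cg by (auto intro: borel_measurable_continuous_onI)
    obtain A where A: "0 \<le> A" "\<And>x. \<bar>\<phi> x\<bar> \<le> A" "\<And>x. norm (gradient \<phi> x) \<le> A"
      using C1_compact_support_bounds[OF \<phi>] by blast
    have cF: "continuous_on ({0..T} \<times> UNIV) (\<lambda>(s, x). F s x)"
      using continuous_on_inner[OF continuous_on_compose2[OF cg cont] cont_vel]
      by (simp add: F_def split_beta)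
    have cFs: "continuous_on {0..t} (\<lambda>s. F s x)" for x
    proof -
      have "continuous_on {0..t} (\<lambda>s. case (s, x) of (s, x) \<Rightarrow> F s x)"
        by (rule continuous_on_compose2[OF cF]) (use t in \<open>auto intro!: continuous_intros\<close>)
      then show ?thesis by simp
    qed
    have bF: "\<bar>F s x\<bar> \<le> (A * B) * (1 + norm x)" if "s \<in> {0..t}" for s x
    proof -
      have "\<bar>F s x\<bar> \<le> norm (gradient \<phi> (X s x)) * norm (vel (X s) (X s x))"
        unfolding F_def by (rule Cauchy_Schwarz_ineq2)
      also have "\<dots> \<le> A * (B * (1 + norm x))"
        using A speed[of s x] that t by (intro mult_mono) (auto simp: B_def)
      finally show ?thesis by (simp add: mult.assoc)
    qed
    have ftc: "\<phi> (X t x) - \<phi> x = (LINT s:{0..t}|lborel. F s x)" for x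
    proof -
      have "((\<lambda>s. F s x) has_integral (\<phi> (X t x) - \<phi> (X 0 x))) {0..t}"
      proof (rule fundamental_theorem_of_calculus)
        fix s assume s: "s \<in> {0..t}"
        have "((\<lambda>s. X s x) has_vector_derivative vel (X s) (X s x)) (at s within {0..t})"
          by (rule has_vector_derivative_within_subset[OF deriv]) (use s t in auto)
        moreover have "(\<phi> has_derivative (\<lambda>v. v \<bullet> gradient \<phi> (X s x))) (at (X s x) within (\<lambda>s. X s x) ` {0..t})"
          using gderiv_gradient[OF d\<phi>, of "X s x"] by (auto simp: gderiv_def intro: has_derivative_at_withinI)
        ultimately have "(\<phi> \<circ> (\<lambda>s. X s x) has_vector_derivative vel (X s) (X s x) \<bullet> gradient \<phi> (X s x))
            (at s within {0..t})"
          by (rule vector_derivative_diff_chain_within)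
        then show "((\<lambda>s. \<phi> (X s x)) has_vector_derivative F s x) (at s within {0..t})"
          by (simp add: F_def comp_def inner_commute)
      qed (use t in auto)
      then show ?thesis
        using set_borel_integral_eq_integral(2)[OF borel_integrable_atLeastAtMost'[OF cFs]]
        by (simp add: X0 integral_unique)
    qed
    have int\<phi>: "integrable \<mu> (\<lambda>x. \<phi> (Y x))" if [measurable]: "Y \<in> borel_measurable \<mu>" for Y
      by (rule integrable_const_bound[of _ A]) (use A in auto)
    have inner: "(LINT x|\<rho> s. gradient \<phi> x \<bullet> conv_vec (gradient V) (\<lambda>y. ln (conv_measure V (\<rho> s) y)) x)
        = - (LINT x|\<mu>. F s x)" if s: "s \<in> {0..T}" for s
    proof -
      note [measurable] = vel_measurable[OF adm[OF s]] meas[OF s]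
      \<comment> \<open>The minus sign in \<open>vel\<close> is compensated here; it reappears as
        the minus sign before the time integral of the weak formulation.\<close>
      have "conv_vec (gradient V) (\<lambda>y. ln (conv_measure V (\<rho> s) y)) = (\<lambda>x. - vel (X s) x)"
        by (simp add: \<rho>_def conv_measure_distr[OF adm[OF s]] vel_def)
      then have "(LINT x|\<rho> s. gradient \<phi> x \<bullet> conv_vec (gradient V) (\<lambda>y. ln (conv_measure V (\<rho> s) y)) x)
          = (LINT x|\<rho> s. - (gradient \<phi> x \<bullet> vel (X s) x))"
        by simp
      also have "\<dots> = (LINT x|\<mu>. - (gradient \<phi> (X s x) \<bullet> vel (X s) (X s x)))"
        unfolding \<rho>_def by (rule integral_distr) measurable
      finally show ?thesis by (simp add: F_def)
    qed
    have "(LINT x|\<rho> t. \<phi> x) - (LINT x|\<rho> 0. \<phi> x) = (LINT x|\<mu>. \<phi> (X t x)) - (LINT x|\<mu>. \<phi> x)"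
      using meas[OF t] by (simp add: \<rho>_def X0 integral_distr)
    also have "\<dots> = (LINT x|\<mu>. \<phi> (X t x) - \<phi> x)"
      using int\<phi>[OF meas[OF t]] int\<phi>[of "\<lambda>x. x"] by simp
    also have "\<dots> = (LINT x|\<mu>. (LINT s:{0..t}|lborel. F s x))"
      by (simp add: ftc)
    also have "\<dots> = (LINT s:{0..t}|lborel. LINT x|\<mu>. F s x)"
    proof (rule swap_time_space[symmetric, OF prob_space_axioms sets_mu integrable_norm_mu _ bF])
      show "continuous_on ({0..t} \<times> UNIV) (\<lambda>(s, x). F s x)"
        by (rule continuous_on_subset[OF cF]) (use t in auto)
    qed
    also have "\<dots> = (LINT s:{0..t}|lborel. - (LINT x|\<rho> s.
        gradient \<phi> x \<bullet> conv_vec (gradient V) (\<lambda>y. ln (conv_measure V (\<rho> s) y)) x))"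
      by (rule set_lebesgue_integral_cong) (use t inner in auto)
    finally show ?thesis
      by (simp add: set_lebesgue_integral_def)
  qed
  ultimately have "weak_measure_solution V T \<rho>"
    by (simp add: weak_measure_solution_def)
  moreover have "\<rho> 0 = \<mu>"
    using sets_mu by (simp add: \<rho>_def X0 distr_id2)
  ultimately show ?thesis by blast
qed

end

section \<open>The rescaled kernels\<close>

lemma power_one_plus_le_exp:
  fixes c :: real
  assumes "0 < c"
  obtains M where "0 < M" "\<And>r. 0 \<le> r \<Longrightarrow> (1 + r) ^ m \<le> M * exp (c * r)"
proof -
  \<comment> \<open>The bound \<open>b \<le> 1\<close> gives
    \<open>b * (1 + r) \<le> 1 + b * r \<le> exp (b * r)\<close>; the second entry ensures
    \<open>b * m \<le> c\<close>, with \<open>m + 1\<close> covering \<open>m = 0\<close>.\<close>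
  define b where "b = min 1 (c / (real m + 1))"
  have b: "0 < b" "b \<le> 1" using assms by (auto simp: b_def)
  have "b * real m \<le> c / (real m + 1) * real m"
    unfolding b_def by (intro mult_right_mono) auto
  also have "\<dots> \<le> c" using assms by (simp add: field_simps)
  finally have bm: "b * real m \<le> c" .
  have "(1 + r) ^ m \<le> (1 / b) ^ m * exp (c * r)" if "0 \<le> r" for r
  proof -
    have "b * (1 + r) \<le> 1 + b * r" using b by (simp add: algebra_simps)
    also have "\<dots> \<le> exp (b * r)" by (rule exp_ge_add_one_self)
    finally have "1 + r \<le> 1 / b * exp (b * r)" using b by (simp add: field_simps)
    then have "(1 + r) ^ m \<le> (1 / b * exp (b * r)) ^ m"
      using that by (intro power_mono) auto
    also have "\<dots> = (1 / b) ^ m * exp (b * real m * r)"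
      by (simp add: power_mult_distrib power_divide mult_ac flip: exp_of_nat_mult)
    also have "\<dots> \<le> (1 / b) ^ m * exp (c * r)"
      using b bm that by (intro mult_left_mono) (auto intro: mult_right_mono)
    finally show ?thesis .
  qed
  then show ?thesis using that[of "(1 / b) ^ m"] b by simp
qed

text \<open>The function is dominated by a series of indicators of the balls of radius
  \<open>n + 1\<close> with weights \<open>exp (- (c * n))\<close>; the term with \<open>n\<close>
  the floor of \<open>norm x\<close> already suffices. Ball volumes grow polynomially, the weights
  decay geometrically.\<close>

lemma integrable_exp_neg_norm:
  fixes c :: real
  assumes "0 < c"
  shows "integrable lborel (\<lambda>x::'a::euclidean_space. exp (- (c * norm x)))"
proof (rule integrableI_nonneg)
  let ?d = "DIM('a)"
  define a where "a n = exp (- (c * real n)) * (unit_ball_vol (real ?d) * (real n + 1) ^ ?d)" for n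
  have a0: "0 \<le> a n" for n by (simp add: a_def)
  have "summable a"
  proof -
    obtain M where M: "0 < M" "\<And>r. 0 \<le> r \<Longrightarrow> (1 + r) ^ ?d \<le> M * exp (c / 2 * r)"
      using power_one_plus_le_exp[of "c / 2" ?d] assms by auto
    have "norm (a n) \<le> unit_ball_vol (real ?d) * M * exp (- (c / 2)) ^ n" for n
    proof -
      have "(real n + 1) ^ ?d \<le> M * exp (c / 2 * real n)"
        using M(2)[of "real n"] by (simp add: add.commute)
      then have "a n \<le> exp (- (c * real n)) * (unit_ball_vol (real ?d) * (M * exp (c / 2 * real n)))"
        unfolding a_def by (intro mult_left_mono) auto
      also have "\<dots> = unit_ball_vol (real ?d) * M * exp (- (c / 2)) ^ n"
        by (simp add: mult_ac flip: exp_of_nat_mult exp_add)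
      finally show ?thesis using a0[of n] by simp
    qed
    moreover have "summable (\<lambda>n. unit_ball_vol (real ?d) * M * exp (- (c / 2)) ^ n)"
      using assms by (intro summable_mult summable_geometric) auto
    ultimately show ?thesis by (rule summable_comparison_test'[rotated, where N = 0])
  qed
  have "(\<integral>\<^sup>+x. ennreal (exp (- (c * norm (x :: 'a)))) \<partial>lborel)
      \<le> (\<integral>\<^sup>+x. (\<Sum>n. ennreal (exp (- (c * real n))) * indicator (ball 0 (real n + 1)) (x :: 'a)) \<partial>lborel)"
  proof (rule nn_integral_mono)
    fix x :: 'a
    define n where "n = nat \<lfloor>norm x\<rfloor>"
    have n: "real n \<le> norm x" "norm x < real n + 1" by (simp_all add: n_def)
    define F where "F k = ennreal (exp (- (c * real k))) * indicator (ball 0 (real k + 1)) x" for k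
    have "ennreal (exp (- (c * norm x))) \<le> F n"
      using n assms by (simp add: F_def indicator_def ennreal_leI)
    also have "\<dots> \<le> suminf F"
      using sum_le_suminf[of F "{n}"] by simp
    finally show "ennreal (exp (- (c * norm x)))
      \<le> (\<Sum>n. ennreal (exp (- (c * real n))) * indicator (ball 0 (real n + 1)) x)"
      by (simp add: F_def[abs_def])
  qed
  also have "\<dots> = (\<Sum>n. \<integral>\<^sup>+x. ennreal (exp (- (c * real n))) * indicator (ball 0 (real n + 1)) (x :: 'a) \<partial>lborel)"
    by (rule nn_integral_suminf)
      (intro borel_measurable_times_ennreal borel_measurable_const borel_measurable_indicator, simp)
  also have "\<dots> = (\<Sum>n. ennreal (a n))"
    by (simp add: nn_integral_cmult_indicator emeasure_ball a_def ennreal_mult)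
  also have "\<dots> < \<infinity>"
    using suminf_ennreal2[OF a0 \<open>summable a\<close>] by simp
  finally show "(\<integral>\<^sup>+x. ennreal (exp (- (c * norm (x :: 'a)))) \<partial>lborel) < \<infinity>" .
qed auto

lemma integrable_power_exp_neg_norm:
  fixes c :: real
  assumes "0 < c"
  shows "integrable lborel (\<lambda>x::'a::euclidean_space. (1 + norm x) ^ m * exp (- (c * norm x)))"
proof -
  \<comment> \<open>Half of the decay absorbs the polynomial, the other half remains
    integrable.\<close>
  obtain M where M: "0 < M" "\<And>r. 0 \<le> r \<Longrightarrow> (1 + r) ^ m \<le> M * exp (c / 2 * r)"
    using power_one_plus_le_exp[of "c / 2" m] assms by auto
  show ?thesis
  proof (rule Bochner_Integration.integrable_bound)
    show "integrable lborel (\<lambda>x::'a. M * exp (- (c / 2 * norm x)))"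
      using assms integrable_exp_neg_norm[of "c / 2"] by auto
    have "(1 + norm x) ^ m * exp (- (c * norm x)) \<le> M * exp (- (c / 2 * norm x))" for x :: 'a
    proof -
      have "(1 + norm x) ^ m * exp (- (c * norm x)) \<le> M * exp (c / 2 * norm x) * exp (- (c * norm x))"
        using M(2)[of "norm x"] by (intro mult_right_mono) auto
      also have "\<dots> = M * exp (- (c / 2 * norm x))"
        by (simp add: mult.assoc flip: exp_add)
      finally show ?thesis .
    qed
    then show "AE x::'a in lborel. norm ((1 + norm x) ^ m * exp (- (c * norm x)))
        \<le> norm (M * exp (- (c / 2 * norm x)))"
      using M(1) by simp
  qed simp
qed

section \<open>The Japanese bracket\<close>

lemma jap_eq_norm: "jap x = norm (1 :: real, x)"
  by (simp add: jap_def norm_Pair)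

lemma jap_ge_1: "1 \<le> jap x"
  by (simp add: jap_def)

lemma norm_le_jap: "norm x \<le> jap x"
  by (simp add: jap_def real_le_rsqrt)

lemma jap_mono: "norm x \<le> norm y \<Longrightarrow> jap x \<le> jap y"
  by (simp add: jap_def power_mono)

text \<open>Triangle inequality for the vectors with first component 1, whose norm is the
  bracket.\<close>

lemma jap_lip: "jap x \<le> jap y + dist x y"
  using norm_triangle_sub[of "(1 :: real, x)" "(1, y)"]
  by (simp add: jap_eq_norm dist_norm norm_Pair)

text \<open>For \<open>p = 1\<close> the bracket is globally Lipschitz, for \<open>p = 2\<close> the
  difference of squares factors; the common form is the one \<open>V_lip\<close> asks for.\<close>

lemma jap_power_lip:
  fixes x y :: "'a::euclidean_space"
  assumes "p = 1 \<or> p = 2"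
  shows "jap x ^ p \<le> jap y ^ p + dist x y * (1 + norm x + norm y)"
  using assms
proof
  assume "p = 1"
  then show ?thesis
    using jap_lip[of x y] mult_left_mono[of 1 "1 + norm x + norm y" "dist x y"] by simp
next
  assume p: "p = 2"
  have "norm x * norm x - norm y * norm y = (norm x - norm y) * (norm x + norm y)"
    by (simp add: algebra_simps)
  also have "\<dots> \<le> dist x y * (1 + norm x + norm y)"
    using norm_triangle_ineq2[of x y] by (intro mult_mono) (auto simp: dist_norm)
  finally show ?thesis
    using p by (simp add: jap_def power2_eq_square)
qed

lemma continuous_jap: "continuous_on UNIV (jap :: 'a::euclidean_space \<Rightarrow> real)"
  unfolding jap_def[abs_def] by (intro continuous_intros)

section \<open>Verification of the mollifier properties for the rescaled kernels\<close>

locale rescaled_kernel =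
  fixes p :: nat and \<epsilon> :: real and V :: "'a::euclidean_space \<Rightarrow> real"
  assumes p: "p = 1 \<or> p = 2" and eps: "0 < \<epsilon>" and V_def: "V = rescale (kernelN p) \<epsilon>"
begin

definition c :: real where
  "c = 1 / ((LINT y|(lborel :: 'a measure). exp (- (jap y ^ p))) * \<epsilon> ^ DIM('a))"

lemma V_eq: "V x = c * exp (- (jap (x /\<^sub>R \<epsilon>) ^ p))"
  by (simp add: V_def rescale_def kernelN_def c_def)

lemma jap_le_power: "jap (x :: 'a) \<le> jap x ^ p"
  using p jap_ge_1[of x] self_le_power[of "jap x" p] by auto

text \<open>The Bochner integral of a non-integrable function is 0 and division by 0 gives 0, so
  without integrability the kernel could be identically 0. Domination by
  \<open>exp (- norm y)\<close> excludes this.\<close>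

lemma integral_pos: "0 < (LINT y|(lborel :: 'a measure). exp (- (jap y ^ p)))"
proof -
  have [measurable]: "(jap :: 'a \<Rightarrow> real) \<in> borel_measurable borel"
    by (rule borel_measurable_continuous_onI[OF continuous_jap])
  have le: "exp (- (jap y ^ p)) \<le> exp (- (1 * norm y))" for y :: 'a
    using jap_le_power[of y] norm_le_jap[of y] by simp
  have int: "integrable lborel (\<lambda>y::'a. exp (- (jap y ^ p)))"
    by (rule Bochner_Integration.integrable_bound[OF integrable_exp_neg_norm[of 1]]) (use le in auto)
  have "(LINT y|(lborel :: 'a measure). exp (- (jap y ^ p))) \<noteq> 0"
    using integral_nonneg_eq_0_iff_AE[OF int] by (simp add: ae_filter_eq_bot_iff)
  moreover have "0 \<le> (LINT y|(lborel :: 'a measure). exp (- (jap y ^ p)))"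
    by (rule Bochner_Integration.integral_nonneg) simp
  ultimately show ?thesis by linarith
qed

lemma c_pos: "0 < c"
  using integral_pos eps by (simp add: c_def)

text \<open>The gradient of the exponent \<open>jap (w /\<^sub>R \<epsilon>) ^ p\<close> is
  \<open>k w *\<^sub>R w\<close>.\<close>

definition k :: "'a \<Rightarrow> real" where
  "k w = (if p = 1 then 1 / (\<epsilon>\<^sup>2 * jap (w /\<^sub>R \<epsilon>)) else 2 / \<epsilon>\<^sup>2)"

lemma k_bound: "\<bar>k w\<bar> \<le> 2 / \<epsilon>\<^sup>2"
proof -
  have "1 / jap (w /\<^sub>R \<epsilon>) \<le> 2"
    using jap_ge_1[of "w /\<^sub>R \<epsilon>"] by (simp add: field_simps)
  then have "(1 / jap (w /\<^sub>R \<epsilon>)) / \<epsilon>\<^sup>2 \<le> 2 / \<epsilon>\<^sup>2"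
    by (rule divide_right_mono) simp
  then show ?thesis
    using jap_ge_1[of "w /\<^sub>R \<epsilon>"] eps by (simp add: k_def mult.commute)
qed

lemma gradient_V: "gradient V w = - ((V w * k w) *\<^sub>R w)"
proof (rule gradient_eqI)
  \<comment> \<open>The square of the bracket is a polynomial. The root is differentiated only for
    \<open>p = 1\<close>, where \<open>q w > 0\<close> is needed; for \<open>p = 2\<close> it
    cancels.\<close>
  define q where "q x = 1 + (x /\<^sub>R \<epsilon>) \<bullet> (x /\<^sub>R \<epsilon>)" for x :: 'a
  have q: "0 < q w" using inner_ge_zero[of "w /\<^sub>R \<epsilon>"] unfolding q_def by linarith
  have jap: "jap (x /\<^sub>R \<epsilon>) = sqrt (q x)" for x
    unfolding jap_def q_def power2_norm_eq_inner ..
  have dq: "(q has_derivative (\<lambda>v. 2 * (w \<bullet> v) / \<epsilon>\<^sup>2)) (at w)"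
    unfolding q_def[abs_def]
    by (rule derivative_eq_intros refl | simp)+
      (auto simp: inner_commute power2_eq_square field_simps)
  show "GDERIV V w :> - ((V w * k w) *\<^sub>R w)"
    using p
  proof
    assume p: "p = 1"
    then have V1: "V = (\<lambda>x. c * exp (- sqrt (q x)))" by (simp add: V_eq[abs_def] jap fun_eq_iff)
    have "((\<lambda>x. sqrt (q x)) has_derivative (\<lambda>v. 2 * (w \<bullet> v) / \<epsilon>\<^sup>2 * (inverse (sqrt (q w)) / 2))) (at w)"
      using has_derivative_real_sqrt[OF q dq] by (simp add: mult.commute)
    then have "(V has_derivative (\<lambda>v. c * (- (2 * (w \<bullet> v) / \<epsilon>\<^sup>2 * (inverse (sqrt (q w)) / 2)) * exp (- sqrt (q w))))) (at w)"
      unfolding V1 by (intro has_derivative_mult_right has_derivative_exp has_derivative_minus)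
    moreover have "c * (- (2 * (w \<bullet> v) / \<epsilon>\<^sup>2 * (inverse (sqrt (q w)) / 2)) * exp (- sqrt (q w)))
        = v \<bullet> - ((V w * k w) *\<^sub>R w)" for v
    proof -
      have "V w = c * exp (- sqrt (q w))" by (rule fun_cong[OF V1])
      moreover have "k w = 1 / (\<epsilon>\<^sup>2 * sqrt (q w))" unfolding k_def jap using p by simp
      ultimately show ?thesis by (simp add: inner_commute[of v w] field_simps)
    qed
    ultimately show ?thesis by (simp add: gderiv_def)
  next
    assume p: "p = 2"
    have "0 \<le> q x" for x
      using inner_ge_zero[of "x /\<^sub>R \<epsilon>"] unfolding q_def by linarith
    then have V2: "V = (\<lambda>x. c * exp (- q x))" by (simp add: V_eq[abs_def] jap p fun_eq_iff)
    have "(V has_derivative (\<lambda>v. c * (- (2 * (w \<bullet> v) / \<epsilon>\<^sup>2) * exp (- q w)))) (at w)"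
      unfolding V2 by (intro has_derivative_mult_right has_derivative_exp has_derivative_minus dq)
    moreover have "c * (- (2 * (w \<bullet> v) / \<epsilon>\<^sup>2) * exp (- q w)) = v \<bullet> - ((V w * k w) *\<^sub>R w)" for v
    proof -
      have "V w = c * exp (- q w)" by (rule fun_cong[OF V2])
      moreover have "k w = 2 / \<epsilon>\<^sup>2" unfolding k_def using p by simp
      ultimately show ?thesis by (simp add: inner_commute[of v w] field_simps)
    qed
    ultimately show ?thesis by (simp add: gderiv_def)
  qed
qed

lemma jap_scaled_continuous: "continuous_on UNIV (\<lambda>w::'a. jap (w /\<^sub>R \<epsilon>))"
  by (rule continuous_on_compose2[OF continuous_jap]) (auto intro!: continuous_intros)

lemma V_continuous: "continuous_on UNIV V"
  unfolding V_eq[abs_def] by (intro continuous_intros jap_scaled_continuous)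

text \<open>Rescaling \<open>jap_power_lip\<close> divides the distance by \<open>\<epsilon>\<close>
  and the norms in the weight by another \<open>\<epsilon>\<close>; the sum of both powers covers
  all terms.\<close>

lemma V_lipschitz:
  "V w' * exp (- ((1 / \<epsilon> + 1 / \<epsilon>\<^sup>2) * dist w w' * (1 + norm w + norm w'))) \<le> V w"
proof -
  let ?a = "w /\<^sub>R \<epsilon>" and ?b = "w' /\<^sub>R \<epsilon>"
  have d: "dist ?a ?b = dist w w' / \<epsilon>"
    using eps by (simp add: dist_norm divide_inverse flip: scaleR_diff_right)
  have n: "norm ?a = norm w / \<epsilon>" "norm ?b = norm w' / \<epsilon>"
    using eps by (simp_all add: divide_inverse)
  have "jap ?a ^ p \<le> jap ?b ^ p + dist w w' / \<epsilon> * (1 + norm w / \<epsilon> + norm w' / \<epsilon>)"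
    using jap_power_lip[OF p, of ?a ?b] unfolding d n .
  also have "dist w w' / \<epsilon> * (1 + norm w / \<epsilon> + norm w' / \<epsilon>)
      = dist w w' * (1 / \<epsilon> + 1 / \<epsilon>\<^sup>2 * (norm w + norm w'))"
    using eps by (simp add: field_simps power2_eq_square)
  also have "\<dots> \<le> dist w w' * ((1 / \<epsilon> + 1 / \<epsilon>\<^sup>2) * (1 + norm w + norm w'))"
    using eps by (intro mult_left_mono) (auto simp: distrib_left distrib_right)
  finally have "jap ?a ^ p \<le> jap ?b ^ p + (1 / \<epsilon> + 1 / \<epsilon>\<^sup>2) * dist w w' * (1 + norm w + norm w')"
    by (simp add: mult_ac)
  then have "exp (- (jap ?b ^ p)) * exp (- ((1 / \<epsilon> + 1 / \<epsilon>\<^sup>2) * dist w w' * (1 + norm w + norm w')))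
      \<le> exp (- (jap ?a ^ p))"
    unfolding exp_add[symmetric] by simp
  then show ?thesis
    using c_pos by (simp add: V_eq mult.assoc)
qed

lemma gradient_V_measurable: "gradient V \<in> borel_measurable borel"
proof -
  have [measurable]: "(\<lambda>w::'a. jap (w /\<^sub>R \<epsilon>)) \<in> borel_measurable borel" "V \<in> borel_measurable borel"
    using jap_scaled_continuous V_continuous by (auto intro: borel_measurable_continuous_onI)
  have "gradient V = (\<lambda>w. - ((V w * k w) *\<^sub>R w))" using gradient_V by blast
  also have "\<dots> \<in> borel_measurable borel" unfolding k_def by measurable
  finally show ?thesis .
qed

lemma gradient_V_integrable:
  "integrable lborel (\<lambda>w. (1 + norm w)\<^sup>2 * norm (gradient V w))"
proof (rule Bochner_Integration.integrable_bound)
  note [measurable] = gradient_V_measurable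
  \<comment> \<open>The cube combines the squared weight with the factor \<open>w\<close> of the
    gradient; the decay rate comes from \<open>norm (w /\<^sub>R \<epsilon>)\<close> bounding the
    exponent from below.\<close>
  let ?g = "\<lambda>w::'a. (c * 2 / \<epsilon>\<^sup>2) * ((1 + norm w) ^ 3 * exp (- (1 / \<epsilon> * norm w)))"
  show "integrable lborel ?g"
    using eps by (intro integrable_mult_right integrable_power_exp_neg_norm) auto
  show "(\<lambda>w. (1 + norm w)\<^sup>2 * norm (gradient V w)) \<in> borel_measurable lborel" by measurable
  have "(1 + norm w)\<^sup>2 * norm (gradient V w) \<le> ?g w" for w :: 'a
  proof -
    have V: "\<bar>V w\<bar> \<le> c * exp (- (1 / \<epsilon> * norm w))"
      using c_pos eps norm_le_jap[of "w /\<^sub>R \<epsilon>"] jap_le_power[of "w /\<^sub>R \<epsilon>"]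
      by (simp add: V_eq divide_inverse mult.commute)
    have "norm (gradient V w) = \<bar>V w\<bar> * \<bar>k w\<bar> * norm w"
      by (simp add: gradient_V abs_mult)
    also have "\<dots> \<le> (c * exp (- (1 / \<epsilon> * norm w))) * (2 / \<epsilon>\<^sup>2) * (1 + norm w)"
      using V k_bound c_pos by (intro mult_mono) auto
    finally have "(1 + norm w)\<^sup>2 * norm (gradient V w)
        \<le> (1 + norm w)\<^sup>2 * ((c * exp (- (1 / \<epsilon> * norm w))) * (2 / \<epsilon>\<^sup>2) * (1 + norm w))"
      by (intro mult_left_mono) auto
    then show ?thesis by (simp add: power3_eq_cube power2_eq_square mult_ac)
  qed
  moreover have "norm ((1 + norm w)\<^sup>2 * norm (gradient V w)) = (1 + norm w)\<^sup>2 * norm (gradient V w)" for w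
    by simp
  ultimately have "norm ((1 + norm w)\<^sup>2 * norm (gradient V w)) \<le> norm (?g w)" for w
    unfolding real_norm_def using abs_ge_self order_trans by metis
  then show "AE w in lborel. norm ((1 + norm w)\<^sup>2 * norm (gradient V w)) \<le> norm (?g w)"
    by blast
qed

lemma mollified_flow:
  assumes "\<mu> \<in> P2"
  shows "mollified_flow \<mu> V (1 / \<epsilon> + 1 / \<epsilon>\<^sup>2)"
proof -
  have \<mu>: "prob_space \<mu>" "sets \<mu> = sets borel" "(\<integral>\<^sup>+x. ennreal ((norm x)\<^sup>2) \<partial>\<mu>) < \<infinity>"
    using assms by (auto simp: P2_def)
  have V_anti: "V w' \<le> V w" if "norm w \<le> norm w'" for w w'
  proof -
    have "jap (w /\<^sub>R \<epsilon>) ^ p \<le> jap (w' /\<^sub>R \<epsilon>) ^ p"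
      using that eps jap_ge_1[of "w /\<^sub>R \<epsilon>"]
      by (intro power_mono jap_mono) (auto simp: mult_left_mono)
    then show ?thesis using c_pos by (simp add: V_eq)
  qed
  have "jap (- x :: 'a) = jap x" for x by (simp add: jap_def)
  then have odd: "gradient V (- w) = - gradient V w" for w
    by (simp add: gradient_V V_eq k_def)
  have [measurable_cong]: "sets \<mu> = sets borel" by fact
  show ?thesis
  proof (intro mollified_flow.intro mollified_flow_axioms.intro)
    show "integrable \<mu> (\<lambda>x. (norm x)\<^sup>2)"
      by (rule integrableI_nonneg) (use \<mu>(3) in auto)
    show "0 \<le> 1 / \<epsilon> + 1 / \<epsilon>\<^sup>2" using eps by simp
    show "0 < V w" for w using c_pos by (simp add: V_eq)
  qed (fact \<mu> V_continuous V_lipschitz gradient_V_measurable gradient_V_integrable odd V_anti)+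
qed

end

theorem theorem3p2:
  fixes T \<epsilon> :: real and p :: nat and \<rho>\<^sub>0 :: "'a::euclidean_space measure"
  assumes "T > 0" and "\<epsilon> > 0" and "p = 1 \<or> p = 2"
    and "\<rho>\<^sub>0 \<in> P2"
    and "reg_entropy (rescale (kernelN p) \<epsilon>) \<rho>\<^sub>0 < \<infinity>"
  shows "\<exists>\<rho>. weak_measure_solution (rescale (kernelN p) \<epsilon>) T \<rho> \<and> \<rho> 0 = \<rho>\<^sub>0"
proof -
  interpret rescaled_kernel p \<epsilon> "rescale (kernelN p) \<epsilon> :: 'a \<Rightarrow> real"
    by unfold_locales (use assms in auto)
  show ?thesis
    using mollified_flow.weak_solution_exists[OF mollified_flow[OF assms(4)]] assms(1) by simp
qed

end
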